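(* There exists a class $\mathcal C$ of finite graphs, closed under isomorphism and under taking induced subgraphs, which is small and has unbounded twin-width, i.e. $\sup_{G\in\mathcal C}\mathrm{tww}(G)=\infty$.
   Context: Graphs are simple and undirected. A class $\mathcal C$ of finite graphs (closed under isomorphism) is small if there is a constant $c$ such that for every $n\ge 1$, $\mathcal C$ contains at most $n!\cdot c^n$ graphs with vertex set $\{1,\dots,n\}$ (labelled graphs). Twin-width: for a finite graph $G$ and a partition $\mathcal P$ of $V(G)$, two distinct parts $X,Y\in\mathcal P$ are joined by a red edge if there is at least one edge and at least one non-edge of $G$ between $X$ and $Y$. A partition sequence of $G$ ($|V(G)|=n$) is a sequence $\mathcal P_n,\dots,\mathcal P_1$ of partitions of $V(G)$, where $\mathcal P_n$ is the partition into singletons, $\mathcal P_1=\{V(G)\}$, and each $\mathcal P_{i-1}$ is obtained from $\mathcal P_i$ by merging two parts. The twin-width $\mathrm{tww}(G)$ is the minimum, over all partition sequences, of the maximum over $i$ of the maximum degree of the red graph on $\mathcal P_i$. *)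

theory Defs
  imports Complex_Main "HOL-Library.Disjoint_Sets" "HOL-Library.Extended_Nat"
begin

datatype 'a graph = Graph (verts: "'a set") (edges: "'a set set")

definition finite_graph :: "'a graph \<Rightarrow> bool" where
  "finite_graph G \<longleftrightarrow>
     finite (verts G) \<and> (\<forall>e\<in>edges G. e \<subseteq> verts G \<and> card e = 2)"

definition isomorphic :: "'a graph \<Rightarrow> 'b graph \<Rightarrow> bool" where
  "isomorphic G H \<longleftrightarrow>
     (\<exists>f. bij_betw f (verts G) (verts H) \<and>
          (\<forall>u\<in>verts G. \<forall>v\<in>verts G. {u, v} \<in> edges G \<longleftrightarrow> {f u, f v} \<in> edges H))"

definition induced_subgraph :: "'a graph \<Rightarrow> 'a set \<Rightarrow> 'a graph" where
  "induced_subgraph G W = Graph W {e \<in> edges G. e \<subseteq> W}"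

text \<open>Every finite graph is isomorphic to one with vertices in \<^typ>\<open>nat\<close>, so an
  isomorphism-closed class of finite graphs is determined by its members on
  natural numbers.\<close>

definition graph_class :: "nat graph set \<Rightarrow> bool" where
  "graph_class C \<longleftrightarrow>
     (\<forall>G\<in>C. finite_graph G) \<and>
     (\<forall>G\<in>C. \<forall>H. finite_graph H \<and> isomorphic G H \<longrightarrow> H \<in> C)"

definition hereditary :: "nat graph set \<Rightarrow> bool" where
  "hereditary C \<longleftrightarrow> (\<forall>G\<in>C. \<forall>W\<subseteq>verts G. induced_subgraph G W \<in> C)"

definition small :: "nat graph set \<Rightarrow> bool" where
  "small C \<longleftrightarrow>
     (\<exists>c::real. \<forall>n\<ge>1. real (card {G \<in> C. verts G = {1..n}}) \<le> fact n * c ^ n)"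

text \<open>The set counted in \<^const>\<open>small\<close> is finite, so its \<^const>\<open>card\<close> is the true
  number of labelled graphs.\<close>

lemma finite_labelled_graphs:
  assumes "graph_class C"
  shows "finite {G \<in> C. verts G = {1..n}}"
proof (rule finite_subset)
  show "{G \<in> C. verts G = {1..n}} \<subseteq> Graph {1..n} ` Pow (Pow {1..n})"
  proof
    fix G assume G: "G \<in> {G \<in> C. verts G = {1..n}}"
    have "edges G \<in> Pow (Pow {1..n})"
      using assms G unfolding graph_class_def finite_graph_def by blast
    moreover have "G = Graph {1..n} (edges G)"
      using G by (cases G) simp
    ultimately show "G \<in> Graph {1..n} ` Pow (Pow {1..n})" by blast
  qed
qed simp

definition red_edge :: "'a graph \<Rightarrow> 'a set \<Rightarrow> 'a set \<Rightarrow> bool" where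
  "red_edge G X Y \<longleftrightarrow>
     X \<noteq> Y \<and> (\<exists>x\<in>X. \<exists>y\<in>Y. {x, y} \<in> edges G) \<and> (\<exists>x\<in>X. \<exists>y\<in>Y. {x, y} \<notin> edges G)"

definition max_red_degree :: "'a graph \<Rightarrow> 'a set set \<Rightarrow> nat" where
  "max_red_degree G P = (MAX X\<in>P. card {Y \<in> P. red_edge G X Y})"

definition merges_to :: "'a set set \<Rightarrow> 'a set set \<Rightarrow> bool" where
  "merges_to P Q \<longleftrightarrow>
     (\<exists>X\<in>P. \<exists>Y\<in>P. X \<noteq> Y \<and> Q = insert (X \<union> Y) (P - {X, Y}))"

text \<open>Only the values \<open>P i\<close> with \<open>1 \<le> i \<le> card (verts G)\<close> are relevant.\<close>

definition partition_sequence :: "'a graph \<Rightarrow> (nat \<Rightarrow> 'a set set) \<Rightarrow> bool" where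
  "partition_sequence G P \<longleftrightarrow>
     (let n = card (verts G) in
        (\<forall>i\<in>{1..n}. partition_on (verts G) (P i)) \<and>
        P n = (\<lambda>v. {v}) ` verts G \<and>
        P 1 = {verts G} \<and>
        (\<forall>i\<in>{2..n}. merges_to (P i) (P (i - 1))))"

definition sequence_width :: "'a graph \<Rightarrow> (nat \<Rightarrow> 'a set set) \<Rightarrow> nat" where
  "sequence_width G P = (MAX i\<in>{1..card (verts G)}. max_red_degree G (P i))"

text \<open>The graph without vertices has no partition sequence in the usual sense; its
  twin-width is 0 by convention. For nonempty finite \<open>G\<close> the infimum ranges over a
  nonempty set of natural numbers and is a minimum.\<close>

definition twin_width :: "'a graph \<Rightarrow> nat" where
  "twin_width G =
     (if verts G = {} then 0
      else (INF P\<in>{P. partition_sequence G P}. sequence_width G P))"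

end

theory Submission
  imports Defs "HOL-Library.FuncSet"
begin

text \<open>There are about \<open>N ^ (3 N)\<close> edge sets on \<open>N\<close> labelled vertices with \<open>3 N\<close> edges, maximum degree
  at most 12 and no cycle shorter than a fixed multiple of \<open>ln N\<close>, up to a factor \<open>c ^ N\<close>: add edges one
  by one, always joining two vertices of degree below 12 at large distance. Far fewer of these
  graphs have twin-width at most \<open>k\<close>. Indeed, run a partition sequence of width \<open>k\<close>, and cut off a piece
  whenever the vertices of a part that are not yet cut off number more than a constant \<open>s\<close>. As a piece
  meets at most \<open>k + 12\<close> other parts when it is cut off, this leaves \<open>N / s\<close> pieces of size at most
  \<open>2 s\<close> with \<open>O(N / s)\<close> adjacencies, so there are at most \<open>N ^ (2 N) * c ^ N\<close> such graphs. Hence there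
  are graphs \<open>G k\<close> of this kind with twin-width above \<open>k\<close>.

  The induced subgraphs of the \<open>G k\<close> form a small class: a component that is too small to contain a
  cycle is a tree, and a larger one is determined by a spanning tree, the place of its root in
  \<open>G k\<close> and one of 12 directions for every other vertex. The root costs \<open>ln N\<close>, which is at most
  a constant per vertex of such a component.\<close>

section \<open>Counting graphs that are locally sparse\<close>

definition nbhd :: "'a set set \<Rightarrow> 'a \<Rightarrow> 'a set" where
  "nbhd E v = {w. {v, w} \<in> E}"

text \<open>Small vertex sets spanning fewer edges than vertices is the same as large girth, but is easier to
  maintain when an edge is added.\<close>

definition locally_sparse :: "nat \<Rightarrow> 'a set set \<Rightarrow> bool" where
  "locally_sparse g E \<longleftrightarrow>
     (\<forall>S. finite S \<and> S \<noteq> {} \<and> card S \<le> g \<longrightarrow> card {e \<in> E. e \<subseteq> S} < card S)"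

fun nball :: "'a set set \<Rightarrow> 'a \<Rightarrow> nat \<Rightarrow> 'a set" where
  "nball E u 0 = {u}"
| "nball E u (Suc i) = nball E u i \<union> (\<Union>v\<in>nball E u i. nbhd E v)"

lemma finite_card_nball:
  assumes "\<And>v. finite (nbhd E v)" "\<And>v. card (nbhd E v) \<le> d"
  shows "finite (nball E u i) \<and> card (nball E u i) \<le> (d + 1) ^ i"
proof (induction i)
  case (Suc i)
  let ?B = "nball E u i"
  have "card (\<Union>v\<in>?B. nbhd E v) \<le> (\<Sum>v\<in>?B. card (nbhd E v))"
    using Suc by (intro card_UN_le) auto
  also have "\<dots> \<le> card ?B * d"
    using sum_bounded_above[of ?B "\<lambda>v. card (nbhd E v)" d] assms by simp
  finally have "card (nball E u (Suc i)) \<le> card ?B + card ?B * d"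
    using card_Un_le[of ?B "\<Union>v\<in>?B. nbhd E v"] by simp
  also have "\<dots> = card ?B * (d + 1)" by simp
  also have "\<dots> \<le> (d + 1) ^ i * (d + 1)"
    using Suc by (intro mult_right_mono) auto
  finally show ?case using Suc assms by (simp add: mult.commute)
qed simp

text \<open>If S is split into two nonempty parts, local sparsity allows at most
  \<open>card S - 2\<close> edges inside the parts, so a set spanning at least
  \<open>card S - 1\<close> edges has an edge across every split. Hence each enlargement of the ball
  about \<open>u\<close> gains a vertex of S until S is exhausted.\<close>

lemma tight_set_subset_nball:
  assumes sp: "locally_sparse g E" and E2: "\<And>e. e \<in> E \<Longrightarrow> card e = 2"
    and S: "finite S" "card S \<le> g" and tight: "card S \<le> Suc (card {e \<in> E. e \<subseteq> S})"
    and u: "u \<in> S"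
  shows "S \<subseteq> nball E u g"
proof -
  have mem: "u \<in> nball E u i" for i by (induction i) auto
  have step: "S \<subseteq> nball E u i \<or> i + 1 \<le> card (nball E u i \<inter> S)" for i
  proof (induction i)
    case 0
    then show ?case using u by simp
  next
    case (Suc i)
    let ?T = "nball E u i \<inter> S"
    show ?case
    proof (cases "S \<subseteq> nball E u i")
      case False
      then have ge: "i + 1 \<le> card ?T" using Suc by blast
      have ne: "?T \<noteq> {}" "S - ?T \<noteq> {}" using False u mem by auto
      have lt: "card {e \<in> E. e \<subseteq> ?T} < card ?T" "card {e \<in> E. e \<subseteq> S - ?T} < card (S - ?T)"
        using sp[unfolded locally_sparse_def, rule_format, of ?T]
          sp[unfolded locally_sparse_def, rule_format, of "S - ?T"]
          S ne card_mono[of S ?T] card_mono[of S "S - ?T"] by force+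
      have cS: "card S = card ?T + card (S - ?T)"
        using S card_Diff_subset[of ?T S] card_mono[of S ?T] by simp
      have fin: "finite {e \<in> E. e \<subseteq> X}" if "X \<subseteq> S" for X
        by (rule finite_subset[of _ "Pow S"]) (use S that in auto)
      have "\<not> {e \<in> E. e \<subseteq> S} \<subseteq> {e \<in> E. e \<subseteq> ?T} \<union> {e \<in> E. e \<subseteq> S - ?T}"
      proof
        assume "{e \<in> E. e \<subseteq> S} \<subseteq> {e \<in> E. e \<subseteq> ?T} \<union> {e \<in> E. e \<subseteq> S - ?T}"
        then have "card {e \<in> E. e \<subseteq> S} \<le> card ({e \<in> E. e \<subseteq> ?T} \<union> {e \<in> E. e \<subseteq> S - ?T})"
          using fin[of ?T] fin[of "S - ?T"] by (intro card_mono finite_UnI) blast+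
        also have "\<dots> \<le> card {e \<in> E. e \<subseteq> ?T} + card {e \<in> E. e \<subseteq> S - ?T}" by (rule card_Un_le)
        finally show False using lt cS tight by linarith
      qed
      then obtain e where e: "e \<in> E" "e \<subseteq> S" "\<not> e \<subseteq> ?T" "\<not> e \<subseteq> S - ?T" by blast
      obtain x y where xy: "e = {x, y}" using E2[OF e(1)] by (meson card_2_iff)
      have "\<exists>x y. e = {x, y} \<and> x \<in> ?T \<and> y \<in> S - ?T"
        using e xy by auto
      then obtain x y where "e = {x, y}" "x \<in> ?T" "y \<in> S - ?T" by blast
      then have "insert y ?T \<subseteq> nball E u (Suc i) \<inter> S" "y \<notin> ?T"
        using e(1) by (auto simp: nbhd_def)
      then have "Suc (card ?T) \<le> card (nball E u (Suc i) \<inter> S)"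
        using S card_mono[of "nball E u (Suc i) \<inter> S" "insert y ?T"] by simp
      then show ?thesis using ge by linarith
    qed auto
  qed
  \<comment> \<open>For \<open>i = g\<close> the second alternative of \<open>step\<close> would
    need more than \<open>g\<close> vertices in S.\<close>
  have "card (nball E u g \<inter> S) \<le> g" using S card_mono[of S "nball E u g \<inter> S"] by simp
  then show ?thesis using step[of g] by linarith
qed

text \<open>Only a set S containing both ends of the new edge can become too dense, and it must have
  been tight before. Tight sets through \<open>u\<close> stay inside the ball of radius
  \<open>g\<close>, which misses \<open>v\<close>.\<close>

lemma locally_sparse_insert:
  fixes E :: "'a set set"
  assumes sp: "locally_sparse g E" and E2: "\<And>e. e \<in> E \<Longrightarrow> card e = 2"
    and v: "v \<notin> nball E u g"
  shows "locally_sparse g (insert {u, v} E)"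
  unfolding locally_sparse_def
proof (intro allI impI)
  fix S :: "'a set" assume S: "finite S \<and> S \<noteq> {} \<and> card S \<le> g"
  have old: "card {e \<in> E. e \<subseteq> S} < card S" using sp S unfolding locally_sparse_def by blast
  have fin: "finite {e \<in> E. e \<subseteq> S}" by (rule finite_subset[of _ "Pow S"]) (use S in auto)
  show "card {e \<in> insert {u, v} E. e \<subseteq> S} < card S"
  proof (cases "{u, v} \<subseteq> S")
    case True
    have "\<not> card S \<le> Suc (card {e \<in> E. e \<subseteq> S})"
      using tight_set_subset_nball[OF sp E2] S True v by blast
    moreover have "{e \<in> insert {u, v} E. e \<subseteq> S} = insert {u, v} {e \<in> E. e \<subseteq> S}" using True by auto
    ultimately show ?thesis using fin by (simp add: card_insert_if)
  next
    case False
    then have "{e \<in> insert {u, v} E. e \<subseteq> S} = {e \<in> E. e \<subseteq> S}" by auto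
    then show ?thesis using old by simp
  qed
qed

definition sparse_edge_sets :: "nat \<Rightarrow> nat \<Rightarrow> 'a set \<Rightarrow> nat \<Rightarrow> 'a set set set" where
  "sparse_edge_sets d g V m = {E. (\<forall>e\<in>E. e \<subseteq> V \<and> card e = 2) \<and> card E = m \<and>
     (\<forall>v. card (nbhd E v) \<le> d) \<and> locally_sparse g E}"

lemma finite_sparse_edge_sets: "finite V \<Longrightarrow> finite (sparse_edge_sets d g V m)"
  by (rule finite_subset[of _ "Pow (Pow V)"]) (auto simp: sparse_edge_sets_def)

lemma nbhd_subset: "\<forall>e\<in>E. e \<subseteq> V \<Longrightarrow> nbhd E v \<subseteq> V"
  by (auto simp: nbhd_def)

lemma sum_card_nbhd_le:
  assumes V: "finite V" and E: "\<forall>e\<in>E. e \<subseteq> V \<and> card e = 2"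
  shows "(\<Sum>v\<in>V. card (nbhd E v)) \<le> 2 * card E"
proof -
  have finE: "finite E" by (rule finite_subset[of _ "Pow V"]) (use V E in auto)
  have "card (nbhd E v) \<le> card {e \<in> E. v \<in> e}" for v
    by (rule card_inj_on_le[of "\<lambda>w. {v, w}"]) (auto simp: inj_on_def nbhd_def doubleton_eq_iff finE)
  then have "(\<Sum>v\<in>V. card (nbhd E v)) \<le> (\<Sum>v\<in>V. card {e \<in> E. v \<in> e})" by (intro sum_mono)
  also have "\<dots> = (\<Sum>e\<in>E. 2)"
  proof (rule sum_multicount_gen[OF V finE])
    have "{v \<in> V. v \<in> e} = e" if "e \<in> E" for e using E that by auto
    then show "\<forall>e\<in>E. card {v \<in> V. v \<in> e} = 2" using E by simp
  qed
  finally show ?thesis by simp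
qed

text \<open>The degree sum is below \<open>2 * d * a\<close>, so fewer than \<open>2 * a\<close> of
  the \<open>4 * a\<close> vertices are saturated. Each of the remaining ones excludes only a ball
  of at most \<open>a\<close> vertices, which leaves it at least \<open>a\<close> unsaturated
  partners.\<close>

lemma card_addable_edges_ge:
  assumes V: "finite V" "card V = 4 * a" and a: "a = (d + 1) ^ g"
    and E: "E \<in> sparse_edge_sets d g V m" and m: "m < d * a" and g: "g \<ge> 1"
  shows "a ^ 2 \<le> card {e. e \<notin> E \<and> insert e E \<in> sparse_edge_sets d g V (Suc m)}"
    (is "_ \<le> card ?A")
proof -
  have E': "\<forall>e\<in>E. e \<subseteq> V \<and> card e = 2" "card E = m" "\<And>v. card (nbhd E v) \<le> d" "locally_sparse g E"
    using E by (auto simp: sparse_edge_sets_def)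
  have finE: "finite E" by (rule finite_subset[of _ "Pow V"]) (use V E' in auto)
  have finN: "finite (nbhd E v)" for v
    using nbhd_subset[of E V v] E'(1) V(1) finite_subset by blast
  define L where "L = {v \<in> V. card (nbhd E v) < d}"
  have "(\<Sum>v\<in>V - L. d) \<le> (\<Sum>v\<in>V - L. card (nbhd E v))"
    by (intro sum_mono) (auto simp: L_def)
  also have "\<dots> \<le> (\<Sum>v\<in>V. card (nbhd E v))" using V by (intro sum_mono2) auto
  also have "\<dots> \<le> 2 * m" using sum_card_nbhd_le[OF V(1) E'(1)] E'(2) by simp
  finally have "card (V - L) * d \<le> 2 * m" by simp
  also have "\<dots> < 2 * a * d" using m by (simp add: mult.commute mult.left_commute)
  finally have "card (V - L) < 2 * a" by simp
  moreover have "L \<subseteq> V" by (auto simp: L_def)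
  ultimately have cL: "2 * a \<le> card L"
    using V by (simp add: card_Diff_subset finite_subset)
  have finL: "finite L" using V by (simp add: L_def)
  \<comment> \<open>R consists of ordered pairs; every addable edge accounts for at most two of
    them.\<close>
  define R where "R = (SIGMA u:L. L - nball E u g)"
  have "a \<le> card (L - nball E u g)" for u
    using diff_card_le_card_Diff[of "nball E u g" L] finite_card_nball[OF finN E'(3), of u g] cL a
    by linarith
  then have "(\<Sum>u\<in>L. a) \<le> (\<Sum>u\<in>L. card (L - nball E u g))" by (intro sum_mono) auto
  moreover have "card R = (\<Sum>u\<in>L. card (L - nball E u g))" using finL by (simp add: R_def)
  ultimately have "2 * a * a \<le> card R"
    using mult_right_mono[OF cL, of a] by (metis le0 le_trans sum_constant of_nat_id)
  moreover have "card R \<le> 2 * card ?A"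
  proof -
    have mem: "{u, v} \<in> ?A" if uv: "u \<in> L" "v \<in> L" "v \<notin> nball E u g" for u v
    proof -
      have self: "u \<in> nball E u i" for i by (induction i) auto
      \<comment> \<open>Because \<open>g\<close> is at least 1, the ball contains all neighbours of
        \<open>u\<close>, so a vertex outside it is not yet joined to \<open>u\<close>.\<close>
      have "nball E u 1 \<subseteq> nball E u g"
        using lift_Suc_mono_le[of "nball E u" 1 g] g by auto
      then have notin: "{u, v} \<notin> E" using uv by (auto simp: nbhd_def)
      have neq: "u \<noteq> v" using self uv by blast
      have "card (nbhd (insert {u, v} E) w) \<le> d" for w
      proof (cases "w = u \<or> w = v")
        case True
        then obtain x where x: "nbhd (insert {u, v} E) w \<subseteq> insert x (nbhd E w)"
          by (auto simp: nbhd_def doubleton_eq_iff)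
        have "card (nbhd (insert {u, v} E) w) \<le> card (insert x (nbhd E w))"
          using x finN by (intro card_mono) auto
        also have "\<dots> \<le> Suc (card (nbhd E w))" using finN by (simp add: card_insert_if)
        finally show ?thesis using True uv by (auto simp: L_def)
      next
        case False
        then have "nbhd (insert {u, v} E) w = nbhd E w" by (auto simp: nbhd_def doubleton_eq_iff)
        then show ?thesis using E'(3) by simp
      qed
      moreover have "locally_sparse g (insert {u, v} E)"
        using locally_sparse_insert[OF E'(4) _ uv(3)] E'(1) by blast
      ultimately show ?thesis
        using E' notin neq finE uv unfolding sparse_edge_sets_def L_def by auto
    qed
    have finA: "finite ?A"
    proof (rule finite_subset)
      show "?A \<subseteq> Pow V" by (auto simp: sparse_edge_sets_def)
    qed (use V in simp)
    have "R \<subseteq> (\<Union>e\<in>?A. {p. {fst p, snd p} = e})"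
      using mem by (auto simp: R_def)
    moreover have fin2: "finite {p. {fst p, snd p} = e} \<and> card {p. {fst p, snd p} = e} \<le> 2"
      if e: "e \<in> ?A" for e
    proof -
      have "card e = 2" using e by (auto simp: sparse_edge_sets_def)
      then obtain x y where "e = {x, y}" by (meson card_2_iff)
      then have sub: "{p. {fst p, snd p} = e} \<subseteq> {(x, y), (y, x)}" by (auto simp: doubleton_eq_iff)
      have "card {(x, y), (y, x)} \<le> 2" by (rule order.trans[OF card_insert_le_m1]) auto
      then have "card {p. {fst p, snd p} = e} \<le> 2"
        using card_mono[OF _ sub] by simp
      then show ?thesis using finite_subset[OF sub] by simp
    qed
    ultimately have "card R \<le> card (\<Union>e\<in>?A. {p. {fst p, snd p} = e})"
      using finA by (intro card_mono) auto
    also have "\<dots> \<le> (\<Sum>e\<in>?A. card {p. {fst p, snd p} = e})" by (rule card_UN_le[OF finA])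
    also have "\<dots> \<le> (\<Sum>e\<in>?A. 2)" using fin2 by (intro sum_mono) auto
    finally show ?thesis by simp
  qed
  ultimately show ?thesis by (simp add: power2_eq_square)
qed

text \<open>Double counting of the pairs of an edge set and an addable edge: adding the edge turns
  them injectively into pairs of a larger edge set and one of its \<open>Suc m\<close>
  edges.\<close>

lemma card_sparse_edge_sets_step:
  assumes V: "finite V" "card V = 4 * a" and a: "a = (d + 1) ^ g"
    and m: "m < d * a" and g: "g \<ge> 1"
  shows "card (sparse_edge_sets d g V m) * a ^ 2 \<le> card (sparse_edge_sets d g V (Suc m)) * Suc m"
proof -
  let ?F = "sparse_edge_sets d g V"
  let ?A = "\<lambda>E. {e. e \<notin> E \<and> insert e E \<in> ?F (Suc m)}"
  have fin: "finite E" if "E \<in> ?F k" for E k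
    by (rule finite_subset[of _ "Pow V"]) (use V that in \<open>auto simp: sparse_edge_sets_def\<close>)
  have finA: "finite (?A E)" for E
    by (rule finite_subset[of _ "Pow V"]) (use V in \<open>auto simp: sparse_edge_sets_def\<close>)
  have finF: "finite (?F k)" for k by (rule finite_sparse_edge_sets[OF V(1)])
  have "card (?F m) * a ^ 2 = (\<Sum>E\<in>?F m. a ^ 2)" by simp
  also have "\<dots> \<le> (\<Sum>E\<in>?F m. card (?A E))"
    by (intro sum_mono card_addable_edges_ge[OF V a _ m g])
  also have "\<dots> = card (SIGMA E:?F m. ?A E)" using finF finA by simp
  also have "\<dots> \<le> card (SIGMA E:?F (Suc m). E)"
  proof (rule card_inj_on_le[of "\<lambda>(E, e). (insert e E, e)"])
    show "inj_on (\<lambda>(E, e). (insert e E, e)) (SIGMA E:?F m. ?A E)"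
      by (rule inj_on_inverseI[of _ "\<lambda>(E, e). (E - {e}, e)"]) auto
    show "finite (SIGMA E:?F (Suc m). E)" using finF fin by blast
  qed auto
  also have "\<dots> = (\<Sum>E\<in>?F (Suc m). card E)" using finF fin by (intro card_SigmaI) auto
  also have "\<dots> = (\<Sum>E\<in>?F (Suc m). Suc m)" by (intro sum.cong) (auto simp: sparse_edge_sets_def)
  finally show ?thesis by simp
qed

lemma card_sparse_edge_sets_ge:
  assumes V: "finite V" "card V = 4 * a" and a: "a = (d + 1) ^ g"
    and m: "m \<le> d * a" and g: "g \<ge> 1"
  shows "a ^ (2 * m) \<le> card (sparse_edge_sets d g V m) * m ^ m"
proof -
  let ?F = "sparse_edge_sets d g V"
  have "a ^ (2 * m) \<le> card (?F m) * fact m" using m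
  proof (induction m)
    case 0
    have "{} \<in> ?F 0"
      by (auto simp: sparse_edge_sets_def nbhd_def locally_sparse_def card_gt_0_iff)
    then have "card (?F 0) > 0" using finite_sparse_edge_sets[OF V(1)] card_gt_0_iff by blast
    then show ?case by simp
  next
    case (Suc m)
    then have "a ^ (2 * Suc m) \<le> card (?F m) * fact m * a ^ 2"
      by (simp add: power2_eq_square mult.assoc[symmetric])
    also have "\<dots> = card (?F m) * a ^ 2 * fact m" by simp
    also have "\<dots> \<le> card (?F (Suc m)) * Suc m * fact m"
      using card_sparse_edge_sets_step[OF V a _ g, of m] Suc.prems by (intro mult_right_mono) auto
    also have "\<dots> = card (?F (Suc m)) * fact (Suc m)" by (simp add: algebra_simps)
    finally show ?case .
  qed
  also have "\<dots> \<le> card (?F m) * m ^ m" using fact_le_power[of m, where 'a = nat] by (intro mult_left_mono) auto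
  finally show ?thesis .
qed

section \<open>Counting graphs of bounded twin-width\<close>

text \<open>This keeps the infimum in \<open>twin_width\<close> from ranging over the empty set. The
  sequence absorbs the vertices one by one into a growing initial segment.\<close>

lemma partition_sequence_exists:
  fixes G :: "nat graph"
  assumes "verts G = {0..<n}" "n > 0"
  shows "\<exists>P. partition_sequence G P"
proof -
  define P where "P i = insert {0..n - i} ((\<lambda>v. {v}) ` {n - i<..<n})" for i
  have card: "card (verts G) = n" using assms by simp
  have part: "partition_on {0..<n} (P i)" if "i \<in> {1..n}" for i
    using that unfolding partition_on_def disjoint_def P_def by auto
  have last: "P n = (\<lambda>v. {v}) ` {0..<n}"
    using assms(2) unfolding P_def by (force simp: image_iff)
  have first: "P 1 = {{0..<n}}"
    using assms(2) unfolding P_def by auto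
  have step: "merges_to (P i) (P (i - 1))" if i: "i \<in> {2..n}" for i
  proof -
    let ?X = "{0..n - i}" and ?Y = "{Suc (n - i)}"
    have X: "?X \<in> P i" by (simp add: P_def)
    have Y: "?Y \<in> P i" using i by (auto simp: P_def)
    have "?X \<union> ?Y = {0..n - (i - 1)}" using i by auto
    moreover have "P i - {?X, ?Y} = (\<lambda>v. {v}) ` {n - (i - 1)<..<n}"
    proof -
      have "{n - i<..<n} = insert (Suc (n - i)) {n - (i - 1)<..<n}" using i by auto
      moreover have "{v} \<noteq> ?X" if "v > n - i" for v using that by (auto simp: set_eq_iff)
      ultimately show ?thesis unfolding P_def using i by auto
    qed
    ultimately have "P (i - 1) = insert (?X \<union> ?Y) (P i - {?X, ?Y})" by (simp add: P_def)
    moreover have "?X \<noteq> ?Y" by (auto simp: set_eq_iff)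
    ultimately show ?thesis unfolding merges_to_def using X Y by (intro bexI[of _ ?X] bexI[of _ ?Y] conjI)
  qed
  have "partition_sequence G P"
    unfolding partition_sequence_def card Let_def using part last first step assms(1) by simp
  then show ?thesis by blast
qed

lemma twin_width_le_imp_partition_sequence:
  fixes G :: "nat graph"
  assumes V: "verts G = {0..<n}" "n > 0" and k: "twin_width G \<le> k"
  obtains P where "partition_sequence G P"
    "\<And>i X. i \<in> {1..n} \<Longrightarrow> X \<in> P i \<Longrightarrow> card {Y \<in> P i. red_edge G X Y} \<le> k"
proof -
  let ?Ps = "{P. partition_sequence G P}"
  have "sequence_width G ` ?Ps \<noteq> {}" using partition_sequence_exists[OF V] by auto
  then have "Inf (sequence_width G ` ?Ps) \<in> sequence_width G ` ?Ps" by (rule Inf_nat_def1)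
  then obtain P where P: "partition_sequence G P" "sequence_width G P = twin_width G"
    using V by (auto simp: twin_width_def)
  have "card {Y \<in> P i. red_edge G X Y} \<le> k" if i: "i \<in> {1..n}" and X: "X \<in> P i" for i X
  proof -
    have "partition_on {0..<n} (P i)"
      using P(1) V i by (simp add: partition_sequence_def Let_def)
    then have "finite (P i)" by (rule finite_elements[rotated]) simp
    then have "card {Y \<in> P i. red_edge G X Y} \<le> max_red_degree G (P i)"
      unfolding max_red_degree_def using X by (intro Max_ge) auto
    also have "\<dots> \<le> sequence_width G P"
      unfolding sequence_width_def using i V by (intro Max_ge) auto
    finally show ?thesis using P(2) k by simp
  qed
  then show ?thesis using P(1) that by blast
qed

text \<open>A part joined to \<open>X\<close> without a red edge is complete to \<open>X\<close>, hence contained in the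
  neighbourhood of every vertex of \<open>X\<close>; disjointness bounds the number of such parts.\<close>

lemma card_quotient_neighbours_le:
  assumes P: "partition_on V P" and V: "finite V" and X: "X \<in> P"
    and red: "card {Y \<in> P. red_edge G X Y} \<le> k"
    and deg: "\<And>v. card (nbhd (edges G) v) \<le> d" "\<And>v. finite (nbhd (edges G) v)"
  shows "card {Y \<in> P. Y \<noteq> X \<and> (\<exists>x\<in>X. \<exists>y\<in>Y. {x, y} \<in> edges G)} \<le> k + d"
proof -
  have finP: "finite P" using finite_elements[OF V P] .
  have "X \<noteq> {}" using P X unfolding partition_on_def by blast
  then obtain x where x: "x \<in> X" by blast
  let ?C = "{Y \<in> P. \<exists>y\<in>Y. y \<in> nbhd (edges G) x}"
  \<comment> \<open>A part that meets the neighbourhood of \<open>x\<close> is recovered from any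
    neighbour it contains, so there are at most \<open>d\<close> such parts.\<close>
  have "?C \<subseteq> (\<lambda>y. THE Y. Y \<in> P \<and> y \<in> Y) ` nbhd (edges G) x"
  proof
    fix Y assume "Y \<in> ?C"
    then obtain y where y: "Y \<in> P" "y \<in> Y" "y \<in> nbhd (edges G) x" by blast
    have "(THE Y. Y \<in> P \<and> y \<in> Y) = Y"
      using y P by (intro the_equality) (auto simp: partition_on_def disjoint_def)
    then show "Y \<in> (\<lambda>y. THE Y. Y \<in> P \<and> y \<in> Y) ` nbhd (edges G) x" using y by force
  qed
  then have "card ?C \<le> card (nbhd (edges G) x)" by (rule surj_card_le[OF deg(2)])
  then have C: "card ?C \<le> d" using deg(1) le_trans by blast
  have "{Y \<in> P. Y \<noteq> X \<and> (\<exists>x\<in>X. \<exists>y\<in>Y. {x, y} \<in> edges G)} \<subseteq> {Y \<in> P. red_edge G X Y} \<union> ?C"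
  proof
    fix Y assume "Y \<in> {Y \<in> P. Y \<noteq> X \<and> (\<exists>x\<in>X. \<exists>y\<in>Y. {x, y} \<in> edges G)}"
    then have Y: "Y \<in> P" "Y \<noteq> X" "\<exists>x\<in>X. \<exists>y\<in>Y. {x, y} \<in> edges G" by auto
    show "Y \<in> {Y \<in> P. red_edge G X Y} \<union> ?C"
    proof (cases "red_edge G X Y")
      case False
      then have "\<forall>x\<in>X. \<forall>y\<in>Y. {x, y} \<in> edges G" using Y by (auto simp: red_edge_def)
      then show ?thesis using x Y by (auto simp: nbhd_def)
    qed (use Y in simp)
  qed
  then have "card {Y \<in> P. Y \<noteq> X \<and> (\<exists>x\<in>X. \<exists>y\<in>Y. {x, y} \<in> edges G)} \<le> card ({Y \<in> P. red_edge G X Y} \<union> ?C)"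
    using finP by (intro card_mono) auto
  also have "\<dots> \<le> k + d" using card_Un_le[of "{Y \<in> P. red_edge G X Y}" ?C] C red by linarith
  finally show ?thesis .
qed

section \<open>Cutting a graph of bounded twin-width into pieces\<close>

text \<open>\<open>F\<close> consists of the pieces cut off so far, \<open>O1\<close> covers the adjacencies among them and \<open>O2\<close> those
  between a piece and the remaining vertices of a part. Each adjacency is charged to the piece that
  was cut off first, hence the bound on \<open>card O1 + card O2\<close>.\<close>

definition pieces_inv ::
  "'a set set \<Rightarrow> 'a set \<Rightarrow> nat \<Rightarrow> nat \<Rightarrow> 'a set set \<Rightarrow> 'a set set \<Rightarrow> ('a set \<times> 'a set) set \<Rightarrow>
   ('a set \<times> 'a set) set \<Rightarrow> bool" where
  "pieces_inv E V s D P F O1 O2 \<longleftrightarrow>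
     disjoint F \<and> \<Union>F \<subseteq> V \<and> (\<forall>A\<in>F. s < card A \<and> card A \<le> 2 * s) \<and>
     (\<forall>Z\<in>P. card (Z - \<Union>F) \<le> s) \<and>
     O1 \<subseteq> F \<times> F \<and> O2 \<subseteq> F \<times> P \<and> card O1 + card O2 \<le> D * card F \<and>
     (\<forall>A\<in>F. \<forall>B\<in>F. \<forall>u\<in>A. \<forall>v\<in>B. {u, v} \<in> E \<and> A \<noteq> B \<longrightarrow> (A, B) \<in> O1 \<or> (B, A) \<in> O1) \<and>
     (\<forall>A\<in>F. \<forall>Z\<in>P. \<forall>u\<in>A. \<forall>v\<in>Z - \<Union>F. {u, v} \<in> E \<longrightarrow> (A, Z) \<in> O2)"

lemma pieces_invI:
  assumes "disjoint F" "\<Union>F \<subseteq> V" "\<And>A. A \<in> F \<Longrightarrow> s < card A \<and> card A \<le> 2 * s"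
    "\<And>Z. Z \<in> P \<Longrightarrow> card (Z - \<Union>F) \<le> s" "O1 \<subseteq> F \<times> F" "O2 \<subseteq> F \<times> P"
    "card O1 + card O2 \<le> D * card F"
    "\<And>A B u v. A \<in> F \<Longrightarrow> B \<in> F \<Longrightarrow> u \<in> A \<Longrightarrow> v \<in> B \<Longrightarrow> {u, v} \<in> E \<Longrightarrow> A \<noteq> B \<Longrightarrow>
      (A, B) \<in> O1 \<or> (B, A) \<in> O1"
    "\<And>A Z u v. A \<in> F \<Longrightarrow> Z \<in> P \<Longrightarrow> u \<in> A \<Longrightarrow> v \<in> Z - \<Union>F \<Longrightarrow> {u, v} \<in> E \<Longrightarrow> (A, Z) \<in> O2"
  shows "pieces_inv E V s D P F O1 O2"
  unfolding pieces_inv_def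
proof (intro conjI)
  show "\<forall>A\<in>F. \<forall>B\<in>F. \<forall>u\<in>A. \<forall>v\<in>B. {u, v} \<in> E \<and> A \<noteq> B \<longrightarrow> (A, B) \<in> O1 \<or> (B, A) \<in> O1"
    by (intro ballI impI, elim conjE) (rule assms(8))
  show "\<forall>A\<in>F. \<forall>Z\<in>P. \<forall>u\<in>A. \<forall>v\<in>Z - \<Union>F. {u, v} \<in> E \<longrightarrow> (A, Z) \<in> O2"
    by (intro ballI impI) (rule assms(9))
  show "\<forall>A\<in>F. s < card A \<and> card A \<le> 2 * s" by (intro ballI assms(3))
  show "\<forall>Z\<in>P. card (Z - \<Union>F) \<le> s" by (intro ballI assms(4))
qed (fact assms)+

text \<open>If at most \<open>s\<close> vertices of the merged part are not cut off, the records of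
  X and Y are simply redirected to it. Otherwise these vertices, at most \<open>2 * s\<close> in
  number, become a new piece. This adds at most D records, which pays for the increase of
  \<open>card F\<close> by one.\<close>

lemma pieces_inv_merge:
  assumes inv: "pieces_inv E V s D P F O1 O2" and P: "partition_on V P" and V: "finite V"
    and XY: "X \<in> P" "Y \<in> P" "X \<noteq> Y" and Q: "Q = insert (X \<union> Y) (P - {X, Y})"
    and Qpart: "partition_on V Q"
    and deg: "card {W \<in> Q. W \<noteq> X \<union> Y \<and> (\<exists>x\<in>X \<union> Y. \<exists>w\<in>W. {x, w} \<in> E)} \<le> D"
  shows "\<exists>F O1 O2. pieces_inv E V s D Q F O1 O2"
proof -
  define M where "M = X \<union> Y"
  have I_disj: "disjoint F" and I_sub: "\<Union>F \<subseteq> V" and I_size: "\<forall>A\<in>F. s < card A \<and> card A \<le> 2 * s"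
    and I_rem: "\<forall>Z\<in>P. card (Z - \<Union>F) \<le> s" and I_O1: "O1 \<subseteq> F \<times> F" and I_O2: "O2 \<subseteq> F \<times> P"
    and I_card: "card O1 + card O2 \<le> D * card F"
    and I_adj1: "\<forall>A\<in>F. \<forall>B\<in>F. \<forall>u\<in>A. \<forall>v\<in>B. {u, v} \<in> E \<and> A \<noteq> B \<longrightarrow> (A, B) \<in> O1 \<or> (B, A) \<in> O1"
    and I_adj2: "\<forall>A\<in>F. \<forall>Z\<in>P. \<forall>u\<in>A. \<forall>v\<in>Z - \<Union>F. {u, v} \<in> E \<longrightarrow> (A, Z) \<in> O2"
    using inv[unfolded pieces_inv_def] by - (elim conjE, assumption)+
  have finP: "finite P" and finQ: "finite Q" using finite_elements[OF V P] finite_elements[OF V Qpart] by simp_all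
  have finF: "finite F" using I_sub V finite_UnionD finite_subset by metis
  have finO2: "finite O2" using I_O2 finF finP finite_subset[of O2 "F \<times> P"] by blast
  \<comment> \<open>\<open>r\<close> renames parts of P to parts of Q; redirecting records along it
    can only identify some of them.\<close>
  define r where "r Z = (if Z \<in> {X, Y} then M else Z)" for Z
  define O2' where "O2' = (\<lambda>(A, Z). (A, r Z)) ` O2"
  have O2': "O2' \<subseteq> F \<times> Q" 
  proof -
    have "r Z \<in> Q" if "Z \<in> P" for Z using that by (auto simp: r_def Q M_def)
    then show ?thesis using I_O2 unfolding O2'_def by fastforce
  qed
  have cO2': "card O2' \<le> card O2" using finO2 by (simp add: O2'_def card_image_le)
  have finO2': "finite O2'" using finO2 by (simp add: O2'_def)
  have adj: "(A, Z) \<in> O2'" if h: "A \<in> F" "Z \<in> Q" "u \<in> A" "v \<in> Z - \<Union>F" "{u, v} \<in> E" for A Z u v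
  proof -
    have "\<exists>Z'\<in>P. v \<in> Z' \<and> r Z' = Z"
    proof (cases "Z = M")
      case True
      then have "v \<in> X \<or> v \<in> Y" using h(4) by (auto simp: M_def)
      then show ?thesis using XY True by (auto simp: r_def)
    next
      case False
      then have "Z \<in> P - {X, Y}" using h(2) by (auto simp: Q M_def)
      then show ?thesis using h(4) by (auto simp: r_def)
    qed
    then obtain Z' where Z': "Z' \<in> P" "v \<in> Z' - \<Union>F" "r Z' = Z" using h(4) by blast
    then have "(A, Z') \<in> O2" using I_adj2 h by blast
    then show ?thesis using Z'(3) by (force simp: O2'_def)
  qed
  define R where "R = M - \<Union>F"
  have "R = (X - \<Union>F) \<union> (Y - \<Union>F)" by (auto simp: R_def M_def)
  then have cR: "card R \<le> 2 * s"
    using card_Un_le[of "X - \<Union>F" "Y - \<Union>F"] I_rem[rule_format, OF XY(1)] I_rem[rule_format, OF XY(2)]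
    by simp
  have MQ: "M \<in> Q" by (simp add: Q M_def)
  show ?thesis
  proof (cases "card R \<le> s")
    case True
    have rem: "card (Z - \<Union>F) \<le> s" if "Z \<in> Q" for Z
      using I_rem True that by (auto simp: Q R_def M_def)
    have "card O1 + card O2' \<le> D * card F" using I_card cO2' by linarith
    then have "pieces_inv E V s D Q F O1 O2'"
      using I_size I_adj1 by (intro pieces_invI[OF I_disj I_sub _ rem I_O1 O2' _ _ adj]) blast+
    then show ?thesis by blast
  next
    case False
    have RV: "R \<subseteq> V" using P XY by (auto simp: R_def M_def partition_on_def)
    \<comment> \<open>R has to be new, so that \<open>card F\<close> really grows and the budget
      rises by D.\<close>
    have RF: "R \<notin> F"
    proof
      assume "R \<in> F"
      then have "R = {}" by (auto simp: R_def)
      then show False using False by simp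
    qed
    have disj: "R \<inter> A = {}" if "A \<in> F" for A using that by (auto simp: R_def)
    have U: "\<Union>(insert R F) = M \<union> \<Union>F" by (auto simp: R_def)
    define N where "N = {W \<in> Q. W \<noteq> M \<and> (\<exists>x\<in>M. \<exists>w\<in>W. {x, w} \<in> E)}"
    have cN: "card N \<le> D" using deg by (auto simp: N_def M_def)
    \<comment> \<open>The records in T point to the merged part, whose uncut vertices now form the
      piece R. They move to \<open>O1'\<close>, and the new records in \<open>O2''\<close> lead from
      R to the at most D parts adjacent to \<open>M\<close>.\<close>
    define T where "T = {p \<in> O2'. snd p = M}"
    define O1' where "O1' = O1 \<union> (\<lambda>p. (fst p, R)) ` T"
    define O2'' where "O2'' = (O2' - T) \<union> {R} \<times> N"
    have finT: "finite T" using finO2' by (simp add: T_def)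
    have "card O1' \<le> card O1 + card T"
      unfolding O1'_def using card_Un_le card_image_le[OF finT] by (meson add_left_mono le_trans)
    moreover have "card O2'' \<le> card (O2' - T) + card N"
      unfolding O2''_def using card_Un_le[of "O2' - T" "{R} \<times> N"] by (simp add: card_cartesian_product)
    moreover have "card T + card (O2' - T) = card O2'"
      using finO2' card_Diff_subset[OF finT, of O2'] card_mono[of O2' T] by (auto simp: T_def)
    ultimately have card: "card O1' + card O2'' \<le> D * card (insert R F)"
      using I_card cN cO2' finF RF by simp
    have sub1: "O1' \<subseteq> insert R F \<times> insert R F"
      using I_O1 O2' unfolding O1'_def T_def by fastforce
    have sub2: "O2'' \<subseteq> insert R F \<times> Q" using O2' unfolding O2''_def N_def by blast
    have size: "card (Z - \<Union>(insert R F)) \<le> s" if Z: "Z \<in> Q" for Z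
    proof (cases "Z = M")
      case True
      then have "Z - \<Union>(insert R F) = {}" unfolding U by blast
      then show ?thesis by (metis card.empty le0)
    next
      case False
      then have ZP: "Z \<in> P" using Z by (auto simp: Q M_def)
      then have "finite Z" using P V by (auto simp: partition_on_def intro: finite_subset)
      then have "card (Z - \<Union>(insert R F)) \<le> card (Z - \<Union>F)" by (intro card_mono) auto
      then show ?thesis using I_rem ZP by (meson le_trans)
    qed
    have adjFR: "(A, R) \<in> O1'" if "A \<in> F" "u \<in> A" "v \<in> R" "{u, v} \<in> E" for A u v
    proof -
      have "(A, M) \<in> O2'" using adj[of A M u v] that MQ by (auto simp: R_def)
      then show ?thesis by (force simp: O1'_def T_def)
    qed
    have adj1: "(A, B) \<in> O1' \<or> (B, A) \<in> O1'"
      if h: "A \<in> insert R F" "B \<in> insert R F" "u \<in> A" "v \<in> B" "{u, v} \<in> E" "A \<noteq> B" for A B u v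
    proof -
      consider "A \<in> F" "B \<in> F" | "A \<in> F" "B = R" | "B \<in> F" "A = R" using h by blast
      then show ?thesis
      proof cases
        case 1
        then have "(A, B) \<in> O1 \<or> (B, A) \<in> O1" using I_adj1 h(3-6) by blast
        then show ?thesis unfolding O1'_def by blast
      next
        case 2
        then show ?thesis using adjFR h by blast
      next
        case 3
        then show ?thesis using adjFR h by (metis insert_commute)
      qed
    qed
    have adj2: "(A, Z) \<in> O2''"
      if h: "A \<in> insert R F" "Z \<in> Q" "u \<in> A" "v \<in> Z - \<Union>(insert R F)" "{u, v} \<in> E" for A Z u v
    proof -
      have ZM: "Z \<noteq> M" using h(4) unfolding U by blast
      show ?thesis
      proof (cases "A = R")
        case True
        then have "Z \<in> N" using h ZM by (auto simp: N_def R_def)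
        then show ?thesis using True by (simp add: O2''_def)
      next
        case False
        then have "(A, Z) \<in> O2'" using adj[of A Z u v] h by auto
        then show ?thesis using ZM by (simp add: O2''_def T_def)
      qed
    qed
    have disj': "disjoint (insert R F)" using I_disj disj by (auto simp: disjoint_def Int_commute)
    have size': "s < card A \<and> card A \<le> 2 * s" if "A \<in> insert R F" for A
      using I_size False cR that by auto
    have sub': "\<Union>(insert R F) \<subseteq> V" using I_sub RV by auto
    have "pieces_inv E V s D Q (insert R F) O1' O2''"
      by (rule pieces_invI[OF disj' sub' size' size sub1 sub2 card adj1 adj2])
    then show ?thesis by blast
  qed
qed

text \<open>The invariant holds for the singletons with no pieces and is carried along all merges.
  At the end fewer than \<open>m\<close> pieces exist, since they are disjoint and larger than
  \<open>s\<close>, and the at most \<open>s\<close> vertices left over form one more colour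
  class.\<close>

lemma bounded_twin_width_pieces:
  fixes G :: "nat graph"
  assumes V: "verts G = {0..<n}" "n > 0" and E: "\<forall>e\<in>edges G. e \<subseteq> verts G"
    and k: "twin_width G \<le> k" and deg: "\<And>v. card (nbhd (edges G) v) \<le> d" and s: "s \<ge> 1"
    and m: "m = n div s + 1"
  obtains col Q where "col \<in> {0..<n} \<rightarrow>\<^sub>E {..<m}" "\<And>i. card {v \<in> {0..<n}. col v = i} \<le> 2 * s"
    "Q \<subseteq> {..<m} \<times> {..<m}" "card Q \<le> (k + d) * m"
    "\<And>u v. {u, v} \<in> edges G \<Longrightarrow> col u = col v \<or> (col u, col v) \<in> Q \<or> (col v, col u) \<in> Q"
proof -
  let ?E = "edges G" and ?V = "{0..<n}"
  have finN: "finite (nbhd ?E v)" for v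
    using finite_subset[OF nbhd_subset[OF E]] V by simp
  obtain P where P: "partition_sequence G P"
    and red: "\<And>i X. i \<in> {1..n} \<Longrightarrow> X \<in> P i \<Longrightarrow> card {Y \<in> P i. red_edge G X Y} \<le> k"
    using twin_width_le_imp_partition_sequence[OF V k] by blast
  have part: "partition_on ?V (P i)" if "i \<in> {1..n}" for i
    using P V that by (simp add: partition_sequence_def Let_def)
  have last: "P n = (\<lambda>v. {v}) ` ?V" and first: "P 1 = {?V}"
    using P V by (simp_all add: partition_sequence_def Let_def)
  have step: "merges_to (P (Suc i)) (P i)" if "1 \<le> i" "i < n" for i
  proof -
    have "\<forall>i\<in>{2..n}. merges_to (P i) (P (i - 1))"
      using P V by (simp add: partition_sequence_def Let_def)
    then have "merges_to (P (Suc i)) (P (Suc i - 1))" by (rule bspec) (use that in auto)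
    then show ?thesis by simp
  qed
  have "\<exists>F O1 O2. pieces_inv ?E ?V s (k + d) (P 1) F O1 O2"
  \<comment> \<open>The induction runs downwards from \<open>P n\<close> to \<open>P 1\<close>, in
    the order of the merges.\<close>
  proof (rule inc_induct[of 1 n])
    have "pieces_inv ?E ?V s (k + d) (P n) {} {} {}"
      by (rule pieces_invI) (use s in \<open>auto simp: last\<close>)
    then show "\<exists>F O1 O2. pieces_inv ?E ?V s (k + d) (P n) F O1 O2" by blast
  next
    fix i assume i: "1 \<le> i" "i < n" and "\<exists>F O1 O2. pieces_inv ?E ?V s (k + d) (P (Suc i)) F O1 O2"
    then obtain F O1 O2 where inv: "pieces_inv ?E ?V s (k + d) (P (Suc i)) F O1 O2" by blast
    obtain X Y where XY: "X \<in> P (Suc i)" "Y \<in> P (Suc i)" "X \<noteq> Y"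
      "P i = insert (X \<union> Y) (P (Suc i) - {X, Y})"
      using step[OF i] unfolding merges_to_def by blast
    have parts: "partition_on ?V (P (Suc i))" "partition_on ?V (P i)" using part i by auto
    have "X \<union> Y \<in> P i" using XY by simp
    then have "card {W \<in> P i. W \<noteq> X \<union> Y \<and> (\<exists>x\<in>X \<union> Y. \<exists>w\<in>W. {x, w} \<in> ?E)} \<le> k + d"
      using i by (intro card_quotient_neighbours_le[OF parts(2)] red deg finN) auto
    then show "\<exists>F O1 O2. pieces_inv ?E ?V s (k + d) (P i) F O1 O2"
      by (intro pieces_inv_merge[OF inv parts(1) _ XY parts(2)]) auto
  qed (use V in simp)
  then obtain F O1 O2 where inv: "pieces_inv ?E ?V s (k + d) {?V} F O1 O2" unfolding first by blast
  have disj: "disjoint F" and sub: "\<Union>F \<subseteq> ?V" and size: "\<forall>A\<in>F. s < card A \<and> card A \<le> 2 * s"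
    and rem: "\<forall>Z\<in>{?V}. card (Z - \<Union>F) \<le> s" and O1: "O1 \<subseteq> F \<times> F" and O2: "O2 \<subseteq> F \<times> {?V}"
    and card_O: "card O1 + card O2 \<le> (k + d) * card F"
    and adj1: "\<forall>A\<in>F. \<forall>B\<in>F. \<forall>u\<in>A. \<forall>v\<in>B. {u, v} \<in> ?E \<and> A \<noteq> B \<longrightarrow> (A, B) \<in> O1 \<or> (B, A) \<in> O1"
    and adj2: "\<forall>A\<in>F. \<forall>Z\<in>{?V}. \<forall>u\<in>A. \<forall>v\<in>Z - \<Union>F. {u, v} \<in> ?E \<longrightarrow> (A, Z) \<in> O2"
    using inv[unfolded pieces_inv_def] by - (elim conjE, assumption)+
  have finU: "finite (\<Union>F)" using sub finite_subset by blast
  then have finF: "finite F" by (rule finite_UnionD)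
  have finA: "finite A" if "A \<in> F" for A using finU that by (meson Union_upper finite_subset)
  have "s * card F \<le> (\<Sum>A\<in>F. card A)"
    using sum_bounded_below[of F s card] size less_imp_le by (metis mult.commute of_nat_id)
  also have "\<dots> = card (\<Union>F)" using disj finA by (intro card_Union_disjoint[symmetric]) (auto simp: disjoint_def pairwise_def disjnt_def)
  also have "\<dots> \<le> n" using card_mono[OF _ sub] by simp
  finally have cF: "card F < m" using s m by (simp add: less_eq_div_iff_mult_less_eq mult.commute less_Suc_eq_le)
  obtain h where h: "bij_betw h F {0..<card F}" using ex_bij_betw_finite_nat[OF finF] by blast
  define piece where "piece v = (THE A. A \<in> F \<and> v \<in> A)" for v
  have piece: "piece v = A" if "A \<in> F" "v \<in> A" for v A
    unfolding piece_def using that disj by (intro the_equality) (auto simp: disjoint_def)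
  \<comment> \<open>The pieces receive the colours below \<open>card F\<close>, and the leftover
    vertices the colour \<open>card F\<close>, which is still below \<open>m\<close>.\<close>
  define col where "col = restrict (\<lambda>v. if v \<in> \<Union>F then h (piece v) else card F) ?V"
  have hlt: "h A < card F" if "A \<in> F" for A using h that by (auto simp: bij_betw_def)
  have col_in: "col v = h A" if "A \<in> F" "v \<in> A" for v A
    using that sub piece[OF that] by (auto simp: col_def)
  have col_out: "col v = card F" if "v \<in> ?V" "v \<notin> \<Union>F" for v
    using that by (simp add: col_def)
  have split: "(\<exists>A\<in>F. v \<in> A \<and> col v = h A) \<or> v \<notin> \<Union>F \<and> col v = card F" if "v \<in> ?V" for v
  proof (cases "v \<in> \<Union>F")
    case True
    then obtain A where "A \<in> F" "v \<in> A" by blast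
    then show ?thesis using col_in[of A v] by blast
  next
    case False
    then show ?thesis using col_out[OF that] by simp
  qed
  \<comment> \<open>A record in \<open>O2\<close> has the whole vertex set as its second component;
    it stands for an adjacency to the leftover class.\<close>
  define Q where "Q = (\<lambda>(A, B). (h A, h B)) ` O1 \<union> (\<lambda>(A, Z). (h A, card F)) ` O2"
  have finO: "finite O1" "finite O2" using O1 O2 finF finite_subset by blast+
  show ?thesis
  proof (rule that)
    show "col \<in> ?V \<rightarrow>\<^sub>E {..<m}"
    proof (intro PiE_I)
      fix v assume "v \<in> ?V"
      then show "col v \<in> {..<m}" using split[of v] cF hlt less_trans by fastforce
    qed (simp add: col_def)
    show "card {v \<in> ?V. col v = i} \<le> 2 * s" for i
    proof (cases "\<exists>A\<in>F. i = h A")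
      case True
      then obtain A where A: "A \<in> F" "i = h A" by blast
      have "{v \<in> ?V. col v = i} \<subseteq> A"
      proof
        fix v assume v: "v \<in> {v \<in> ?V. col v = i}"
        then obtain B where "B \<in> F" "v \<in> B" "col v = h B" using split[of v] hlt[OF A(1)] A(2) by auto
        then show "v \<in> A" using v A h by (auto simp: bij_betw_def inj_on_def)
      qed
      then show ?thesis using card_mono[OF finA[OF A(1)]] size A(1) le_trans by blast
    next
      case False
      then have "{v \<in> ?V. col v = i} \<subseteq> ?V - \<Union>F" using split by auto
      then have "card {v \<in> ?V. col v = i} \<le> card (?V - \<Union>F)" by (intro card_mono) auto
      then show ?thesis using rem by simp
    qed
    show "Q \<subseteq> {..<m} \<times> {..<m}"
    proof -
      have "h A < m" if "A \<in> F" for A using hlt[OF that] cF by simp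
      then show ?thesis unfolding Q_def using O1 O2 cF by fastforce
    qed
    have "card Q \<le> card O1 + card O2"
      unfolding Q_def by (rule order.trans[OF card_Un_le]) (intro add_mono card_image_le finO)
    also have "\<dots> \<le> (k + d) * m" using card_O cF by (meson le_trans less_imp_le mult_le_mono2)
    finally show "card Q \<le> (k + d) * m" .
    fix u v assume uv: "{u, v} \<in> ?E"
    then have mem: "u \<in> ?V" "v \<in> ?V" using E V by auto
    have half: "(col u, col v) \<in> Q"
      if "A \<in> F" "u \<in> A" "v \<notin> \<Union>F" "{u, v} \<in> ?E" "v \<in> ?V" for A u v
    proof -
      have "(A, ?V) \<in> O2" using adj2 that by blast
      then show ?thesis using col_in[OF that(1,2)] col_out[OF that(5,3)] unfolding Q_def by force
    qed
    show "col u = col v \<or> (col u, col v) \<in> Q \<or> (col v, col u) \<in> Q"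
    proof (cases "u \<in> \<Union>F")
      case True
      then obtain A where A: "A \<in> F" "u \<in> A" by blast
      show ?thesis
      proof (cases "v \<in> \<Union>F")
        case True
        then obtain B where B: "B \<in> F" "v \<in> B" by blast
        have "A = B \<or> (A, B) \<in> O1 \<or> (B, A) \<in> O1" using adj1 A B uv by blast
        then show ?thesis using col_in[OF A] col_in[OF B] unfolding Q_def by force
      next
        case False
        then show ?thesis using half[OF A] uv mem by blast
      qed
    next
      case False
      show ?thesis
      proof (cases "v \<in> \<Union>F")
        case True
        then obtain B where "B \<in> F" "v \<in> B" by blast
        then show ?thesis using half[of B v u] uv mem False by (simp add: insert_commute)
      next
        case False
        then show ?thesis using col_out mem \<open>u \<notin> \<Union>F\<close> by simp
      qed
    qed
  qed
qed

text \<open>The three factors count the colourings, the lists of \<open>(k + d) * m\<close> colour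
  pairs, and the subsets of the candidate edges. Once colouring and list are fixed, an edge must lie
  inside a class or between the classes of a listed pair, and each such pair of classes offers at
  most \<open>(2 * s) ^ 2\<close> candidates.\<close>

lemma card_bounded_twin_width_le:
  assumes n: "n > 0" and s: "s \<ge> 1" and m: "m = n div s + 1"
  shows "card {E \<in> sparse_edge_sets d g {0..<n} M. twin_width (Graph {0..<n} E) \<le> k}
    \<le> m ^ n * (m * m) ^ ((k + d) * m) * 2 ^ ((m + (k + d) * m) * (2 * s * (2 * s)))"
proof -
  let ?V = "{0..<n}" and ?r = "(k + d) * m"
  let ?S = "{E \<in> sparse_edge_sets d g ?V M. twin_width (Graph ?V E) \<le> k}"
  let ?cls = "\<lambda>col i. {v \<in> ?V. col v = i}"
  define I where "I = {col \<in> ?V \<rightarrow>\<^sub>E {..<m}. \<forall>i. card (?cls col i) \<le> 2 * s} \<times> ({..<?r} \<rightarrow>\<^sub>E {..<m} \<times> {..<m})"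
  \<comment> \<open>The diagonal pairs account for the edges inside a colour class.\<close>
  define J where "J h = (\<lambda>i. (i, i)) ` {..<m} \<union> h ` {..<?r}" for h :: "nat \<Rightarrow> nat \<times> nat"
  define T where "T p = (\<lambda>(u, v). {u, v}) ` (\<Union>q\<in>J (snd p). ?cls (fst p) (fst q) \<times> ?cls (fst p) (snd q))"
    for p :: "(nat \<Rightarrow> nat) \<times> (nat \<Rightarrow> nat \<times> nat)"
  have finI: "finite I" unfolding I_def
    by (intro finite_cartesian_product finite_PiE finite_subset[of "{col \<in> ?V \<rightarrow>\<^sub>E {..<m}. \<forall>i. card (?cls col i) \<le> 2 * s}" "?V \<rightarrow>\<^sub>E {..<m}"]) auto
  have "card I \<le> card ((?V \<rightarrow>\<^sub>E {..<m}) \<times> ({..<?r} \<rightarrow>\<^sub>E {..<m} \<times> {..<m}))"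
    unfolding I_def by (intro card_mono finite_cartesian_product finite_PiE) auto
  also have "\<dots> = m ^ n * (m * m) ^ ?r" by (simp add: card_cartesian_product card_PiE)
  finally have cI: "card I \<le> m ^ n * (m * m) ^ ?r" .
  have finJ: "finite (J h)" for h by (simp add: J_def)
  have cJ: "card (J h) \<le> m + ?r" for h
    unfolding J_def
    by (rule order.trans[OF card_Un_le], rule add_mono; rule order.trans[OF card_image_le]) simp_all
  have finT: "finite (T p)" for p unfolding T_def using finJ by auto
  have cT: "card (T p) \<le> (m + ?r) * (2 * s * (2 * s))" if p: "p \<in> I" for p
  proof -
    have cls: "card (?cls (fst p) i) \<le> 2 * s" for i using p by (auto simp: I_def)
    have "card (T p) \<le> card (\<Union>q\<in>J (snd p). ?cls (fst p) (fst q) \<times> ?cls (fst p) (snd q))"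
      unfolding T_def using finJ by (intro card_image_le) auto
    also have "\<dots> \<le> (\<Sum>q\<in>J (snd p). card (?cls (fst p) (fst q) \<times> ?cls (fst p) (snd q)))"
      by (rule card_UN_le[OF finJ])
    also have "\<dots> \<le> (\<Sum>q\<in>J (snd p). 2 * s * (2 * s))"
      unfolding card_cartesian_product by (intro sum_mono mult_mono cls) auto
    also have "\<dots> \<le> (m + ?r) * (2 * s * (2 * s))"
      unfolding sum_constant of_nat_id by (intro mult_right_mono cJ) simp
    finally show ?thesis .
  qed
  have "?S \<subseteq> (\<Union>p\<in>I. Pow (T p))"
  proof
    fix E assume "E \<in> ?S"
    then have E: "\<forall>e\<in>E. e \<subseteq> ?V \<and> card e = 2" "\<And>v. card (nbhd E v) \<le> d" "twin_width (Graph ?V E) \<le> k"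
      by (auto simp: sparse_edge_sets_def)
    obtain col Q where col: "col \<in> ?V \<rightarrow>\<^sub>E {..<m}" "\<And>i. card (?cls col i) \<le> 2 * s"
      and Q: "Q \<subseteq> {..<m} \<times> {..<m}" "card Q \<le> ?r"
      and adj: "\<And>u v. {u, v} \<in> E \<Longrightarrow> col u = col v \<or> (col u, col v) \<in> Q \<or> (col v, col u) \<in> Q"
      using bounded_twin_width_pieces[of "Graph ?V E" n k d s m] E n s m by (auto simp: Ball_def)
    have "\<exists>h \<in> {..<?r} \<rightarrow>\<^sub>E {..<m} \<times> {..<m}. Q \<subseteq> h ` {..<?r}"
    proof -
      have "finite Q" using Q(1) finite_subset by blast
      then obtain f where f: "bij_betw f {..<card Q} Q"
        using ex_bij_betw_nat_finite by (metis lessThan_atLeast0)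
      \<comment> \<open>A list that is too short is padded with \<open>(0, 0)\<close>, a legitimate
        colour pair because \<open>m\<close> is positive.\<close>
      define h where "h = restrict (\<lambda>i. if i < card Q then f i else (0, 0)) {..<?r}"
      have "h \<in> {..<?r} \<rightarrow>\<^sub>E {..<m} \<times> {..<m}"
        using f Q(1) m unfolding h_def bij_betw_def by (intro restrict_PiE_iff[THEN iffD2]) auto
      moreover have "Q \<subseteq> h ` {..<?r}"
      proof
        fix q assume "q \<in> Q"
        then obtain i where "i < card Q" "q = f i" using f by (auto simp: bij_betw_def)
        then show "q \<in> h ` {..<?r}" using Q(2) by (auto simp: h_def intro!: image_eqI[of _ _ i])
      qed
      ultimately show ?thesis by blast
    qed
    then obtain h where h: "h \<in> {..<?r} \<rightarrow>\<^sub>E {..<m} \<times> {..<m}" "Q \<subseteq> h ` {..<?r}" by blast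
    have half: "{u, v} \<in> T (col, h)"
      if "u \<in> ?V" "v \<in> ?V" "(col u, col v) \<in> J h" for u v
    proof -
      have "(u, v) \<in> (\<Union>q\<in>J h. ?cls col (fst q) \<times> ?cls col (snd q))" using that by force
      then show ?thesis unfolding T_def by force
    qed
    have "E \<subseteq> T (col, h)"
    proof
      fix e assume e: "e \<in> E"
      then obtain u v where uv: "e = {u, v}" using E(1) by (meson card_2_iff)
      have mem: "u \<in> ?V" "v \<in> ?V" using E(1) e uv by blast+
      then have "col u < m" using col(1) by auto
      then have "(col u, col v) \<in> J h \<or> (col v, col u) \<in> J h"
        using adj[of u v] e uv h(2) unfolding J_def by auto
      then show "e \<in> T (col, h)" using half[OF mem] half[OF mem(2,1)] uv by (auto simp: insert_commute)
    qed
    moreover have "(col, h) \<in> I" using col h by (simp add: I_def)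
    ultimately show "E \<in> (\<Union>p\<in>I. Pow (T p))" by blast
  qed
  then have "card ?S \<le> card (\<Union>p\<in>I. Pow (T p))" using finI finT by (intro card_mono) auto
  also have "\<dots> \<le> (\<Sum>p\<in>I. card (Pow (T p)))" by (rule card_UN_le[OF finI])
  also have "\<dots> \<le> (\<Sum>p\<in>I. 2 ^ ((m + ?r) * (2 * s * (2 * s))))"
    using finT cT by (intro sum_mono) (simp add: card_Pow power_increasing)
  also have "\<dots> = card I * 2 ^ ((m + ?r) * (2 * s * (2 * s)))" by simp
  also have "\<dots> \<le> m ^ n * (m * m) ^ ?r * 2 ^ ((m + ?r) * (2 * s * (2 * s)))"
    by (intro mult_right_mono cI) simp
  finally show ?thesis .
qed

section \<open>Comparing the two counts\<close>

text \<open>There are at least \<open>(a / 12) ^ (12 a)\<close> locally sparse edge sets on \<open>4 a\<close>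
  vertices, but only \<open>O(a) ^ (8 a)\<close> of them have twin-width at most \<open>k\<close>.\<close>

lemma locally_sparse_large_twin_width:
  "\<exists>g\<ge>k. \<exists>E. (\<forall>e\<in>E. e \<subseteq> {0..<4 * 13 ^ g} \<and> card e = 2) \<and> (\<forall>v. card (nbhd E v) \<le> 12) \<and>
     locally_sparse g E \<and> k < twin_width (Graph {0..<4 * 13 ^ g :: nat} E)"
proof -
  \<comment> \<open>D bounds the adjacencies charged to a piece. The choice \<open>s = 4 * D\<close>
    gives \<open>2 * (D * m) \<le> n\<close>, so that listing the colour pairs costs at most
    \<open>n ^ n\<close>; \<open>K ^ n\<close> bounds the choice of edges, and \<open>b\<close>
    collects the constants of the final comparison. Finally \<open>g\<close> is large enough for
    \<open>13 ^ g\<close> to exceed \<open>b\<close>.\<close>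
  define D where "D = k + 12"
  define s where "s = 4 * D"
  define K :: nat where "K = 2 ^ (4 * s ^ 2)"
  define b where "b = 16 * K * 12 ^ 3"
  define g where "g = Suc (k + s + b)"
  define a :: nat where "a = 13 ^ g"
  define n where "n = 4 * a"
  define m where "m = n div s + 1"
  define M where "M = 12 * a"
  have "g < a" unfolding a_def by (rule power_gt_expt) simp
  then have a: "b < a" "s \<le> n" "0 < a" by (auto simp: g_def n_def)
  have s: "s \<ge> 1" "D \<ge> 1" by (auto simp: s_def D_def)
  have n: "n > 0" using a by (simp add: n_def)
  let ?F = "sparse_edge_sets 12 g {0..<n} M"
  have "\<exists>E\<in>?F. k < twin_width (Graph {0..<n} E)"
  proof (rule ccontr)
    assume "\<not> ?thesis"
    then have F: "{E \<in> ?F. twin_width (Graph {0..<n} E) \<le> k} = ?F" by (auto simp: not_less)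
    have "s * m \<le> n + s" by (simp add: m_def)
    then have "s * m \<le> 2 * n" using a by simp
    then have Dm: "2 * (D * m) \<le> n" by (simp add: s_def)
    moreover have "m \<le> D * m" using s by simp
    ultimately have mn: "m \<le> n" "m + D * m \<le> n" by linarith+
    have "card ?F \<le> m ^ n * (m * m) ^ (D * m) * 2 ^ ((m + D * m) * (2 * s * (2 * s)))"
      using card_bounded_twin_width_le[OF n s(1) m_def, of 12 g M k] unfolding F D_def .
    also have "\<dots> \<le> n ^ n * n ^ n * 2 ^ (n * (4 * s ^ 2))"
    proof (intro mult_mono)
      show "m ^ n \<le> n ^ n" using mn by (intro power_mono) auto
      have "(m * m) ^ (D * m) = m ^ (2 * (D * m))" by (simp add: power_mult power2_eq_square)
      also have "\<dots> \<le> n ^ (2 * (D * m))" using mn by (intro power_mono) auto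
      also have "\<dots> \<le> n ^ n" using Dm n by (intro power_increasing) auto
      finally show "(m * m) ^ (D * m) \<le> n ^ n" .
      show "2 ^ ((m + D * m) * (2 * s * (2 * s))) \<le> (2::nat) ^ (n * (4 * s ^ 2))"
        using mn by (intro power_increasing) (auto simp: power2_eq_square)
    qed auto
    also have "\<dots> = (n * n * K) ^ n"
      by (simp add: K_def power_mult_distrib power_mult[symmetric] mult.commute)
    finally have upper: "card ?F \<le> (n * n * K) ^ n" .
    \<comment> \<open>After taking \<open>a\<close>-th roots, the lower bound contributes the
      exponent 24 of \<open>a\<close> and the upper bound only 8 + 12, which forces
      \<open>a \<le> b\<close>.\<close>
    have "a ^ (2 * M) \<le> card ?F * M ^ M"
      by (rule card_sparse_edge_sets_ge) (auto simp: n_def a_def M_def g_def)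
    also have "\<dots> \<le> (n * n * K) ^ n * M ^ M" using upper by (rule mult_right_mono) simp
    also have "\<dots> = ((n * n * K) ^ 4) ^ a * (M ^ 12) ^ a"
      by (simp only: n_def M_def power_mult)
    also have "\<dots> = ((n * n * K) ^ 4 * M ^ 12) ^ a" by (simp only: power_mult_distrib)
    also have "a ^ (2 * M) = (a ^ 24) ^ a" by (simp add: M_def power_mult[symmetric])
    finally have "a ^ 24 \<le> (n * n * K) ^ 4 * M ^ 12"
      using a(3) by (simp add: power_mono_iff)
    also have "(n * n * K) ^ 4 = a ^ 8 * (16 * K) ^ 4"
      by (simp add: n_def power_mult_distrib algebra_simps flip: power_add)
    also have "M ^ 12 = a ^ 12 * (12 ^ 3) ^ 4"
      by (simp add: M_def power_mult_distrib)
    also have "a ^ 8 * (16 * K) ^ 4 * (a ^ 12 * (12 ^ 3) ^ 4) = (a ^ 8 * a ^ 12) * ((16 * K) ^ 4 * (12 ^ 3) ^ 4)"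
      by (simp only: ac_simps)
    also have "\<dots> = a ^ 20 * b ^ 4"
      by (simp only: b_def power_mult_distrib power_add[symmetric]) simp
    finally have "a ^ 20 * a ^ 4 \<le> a ^ 20 * b ^ 4" by (simp flip: power_add)
    then have "a ^ 4 \<le> b ^ 4" by (rule mult_left_le_imp_le) (use a(3) in simp)
    then have "a \<le> b" using power_mono_iff[of a b 4] by simp
    then show False using a(1) by simp
  qed
  then obtain E where "E \<in> ?F" "k < twin_width (Graph {0..<n} E)" by blast
  then show ?thesis
    unfolding n_def a_def sparse_edge_sets_def
    by (intro exI[of _ g] exI[of _ E] conjI) (auto simp: g_def)
qed

section \<open>Counting induced subgraphs of a locally sparse graph\<close>

text \<open>A breadth-first forest: \<open>rt\<close> chooses one vertex per component,
  \<open>rank\<close> is the distance from it, and \<open>p\<close> goes one step back along a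
  shortest path.\<close>

lemma rooted_spanning_forest:
  fixes E :: "'a set set"
  obtains rt p and rank :: "'a \<Rightarrow> nat" where
    "\<And>v. rt (rt v) = rt v" "\<And>u v. {u, v} \<in> E \<Longrightarrow> rt u = rt v"
    "\<And>v. rt v \<noteq> v \<Longrightarrow> {v, p v} \<in> E" "\<And>v. rt v \<noteq> v \<Longrightarrow> rank (p v) < rank v"
    "\<And>V v. \<Union>E \<subseteq> V \<Longrightarrow> v \<in> V \<Longrightarrow> rt v \<in> V"
proof -
  define A where "A = {(u, v). {u, v} \<in> E}"
  have "sym A" by (auto simp: A_def sym_def insert_commute)
  then have symA: "sym (A\<^sup>*)" by (rule sym_rtrancl)
  define rt where "rt v = (SOME r. (v, r) \<in> A\<^sup>*)" for v
  have rt: "(v, rt v) \<in> A\<^sup>*" for v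
    unfolding rt_def by (rule someI[of _ v]) simp
  have rt_eq: "rt u = rt v" if "(u, v) \<in> A\<^sup>*" for u v
  proof -
    \<comment> \<open>Connected vertices reach the same vertices, so \<open>SOME\<close> makes the
      same choice for both.\<close>
    have "(u, r) \<in> A\<^sup>* \<longleftrightarrow> (v, r) \<in> A\<^sup>*" for r
      using that symA by (meson rtrancl_trans symD)
    then show ?thesis by (simp add: rt_def)
  qed
  define rank where "rank v = (LEAST i. (rt v, v) \<in> A ^^ i)" for v
  have rank: "(rt v, v) \<in> A ^^ rank v" for v
  proof -
    have "\<exists>i. (rt v, v) \<in> A ^^ i" using rt[of v] symA by (meson rtrancl_power symD)
    then show ?thesis unfolding rank_def by (rule LeastI_ex)
  qed
  have "\<exists>w. {v, w} \<in> E \<and> rank w < rank v" if "rt v \<noteq> v" for v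
  proof (cases "rank v")
    case 0
    then show ?thesis using rank[of v] that by simp
  next
    case (Suc j)
    then have "(rt v, v) \<in> A ^^ Suc j" using rank[of v] by simp
    then obtain w where w: "(rt v, w) \<in> A ^^ j" "(w, v) \<in> A" by (rule relpow_Suc_E)
    then have "rt w = rt v" using rt_eq by blast
    then have "rank w \<le> j" using w(1) unfolding rank_def by (intro Least_le) simp
    then show ?thesis using Suc w(2) by (auto simp: A_def insert_commute)
  qed
  then obtain p where p: "\<And>v. rt v \<noteq> v \<Longrightarrow> {v, p v} \<in> E \<and> rank (p v) < rank v" by metis
  have inV: "rt v \<in> V" if "\<Union>E \<subseteq> V" "v \<in> V" for V v
    using rt[of v]
  proof (induction rule: rtrancl_induct)
    case (step y z)
    then show ?case using that(1) by (auto simp: A_def)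
  qed (fact that)
  show ?thesis
  proof (rule that[of rt p rank])
    show "rt (rt v) = rt v" for v using rt_eq[OF rt[of v]] by simp
    show "rt u = rt v" if "{u, v} \<in> E" for u v
      using rt_eq[of u v] that by (auto simp: A_def)
  qed (use p inV in auto)
qed

text \<open>A component with \<open>c\<close> vertices has \<open>c - 1\<close> parent edges already, so local sparsity leaves
  no room for others.\<close>

lemma sparse_component_edge:
  assumes V: "finite V" and E: "\<forall>e\<in>E. e \<subseteq> V \<and> card e = 2"
    and sp: "\<And>S. S \<subseteq> V \<Longrightarrow> S \<noteq> {} \<Longrightarrow> card S \<le> g \<Longrightarrow> card {e \<in> E. e \<subseteq> S} < card S"
    and rt: "\<And>v. rt (rt v) = rt v" "\<And>u v. {u, v} \<in> E \<Longrightarrow> rt u = rt v"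
      "\<And>v. v \<in> V \<Longrightarrow> rt v \<in> V"
    and p: "\<And>v. rt v \<noteq> v \<Longrightarrow> {v, p v} \<in> E"
      "\<And>v. rt v \<noteq> v \<Longrightarrow> (rank (p v) :: nat) < rank v"
    and uv: "{u, v} \<in> E" and small: "card {w \<in> V. rt w = rt u} \<le> g"
  shows "\<exists>w\<in>V. rt w = rt u \<and> rt w \<noteq> w \<and> {u, v} = {w, p w}"
proof -
  define C where "C = {w \<in> V. rt w = rt u}"
  have uV: "u \<in> V" "v \<in> V" using uv E by auto
  have C: "finite C" "u \<in> C" "v \<in> C" "rt u \<in> C"
    using V uV rt uv by (auto simp: C_def)
  have sub: "(\<lambda>w. {w, p w}) ` (C - {rt u}) \<subseteq> {e \<in> E. e \<subseteq> C}"
  proof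
    fix e assume "e \<in> (\<lambda>w. {w, p w}) ` (C - {rt u})"
    then obtain w where w: "w \<in> C" "w \<noteq> rt u" "e = {w, p w}" by blast
    then have "rt w \<noteq> w" by (auto simp: C_def)
    then have "{w, p w} \<in> E" by (rule p)
    then show "e \<in> {e \<in> E. e \<subseteq> C}" using w rt(2)[of w "p w"] E by (auto simp: C_def)
  qed
  \<comment> \<open>Two vertices with the same parent edge would be each other's parents, but
    \<open>rank\<close> drops from a vertex to its parent.\<close>
  have "inj_on (\<lambda>w. {w, p w}) (C - {rt u})"
  proof (rule inj_onI, rule ccontr)
    fix x y assume xy: "x \<in> C - {rt u}" "y \<in> C - {rt u}" "{x, p x} = {y, p y}" "x \<noteq> y"
    then have "x = p y" "y = p x" by (auto simp: doubleton_eq_iff)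
    moreover have "rt x \<noteq> x" "rt y \<noteq> y" using xy by (auto simp: C_def)
    ultimately show False using p(2)[of x] p(2)[of y] by simp
  qed
  then have "card ((\<lambda>w. {w, p w}) ` (C - {rt u})) = card C - 1"
    using C by (simp add: card_image)
  moreover have "card {e \<in> E. e \<subseteq> C} < card C"
    using C small by (intro sp) (auto simp: C_def)
  moreover have "finite {e \<in> E. e \<subseteq> C}"
    by (rule finite_subset[of _ "Pow C"]) (use C in auto)
  ultimately have eq: "(\<lambda>w. {w, p w}) ` (C - {rt u}) = {e \<in> E. e \<subseteq> C}"
    using sub by (intro card_seteq) linarith+
  have "{u, v} \<in> (\<lambda>w. {w, p w}) ` (C - {rt u})" unfolding eq using C uv by simp
  then obtain w where w: "{u, v} = {w, p w}" "w \<in> C - {rt u}" by (rule imageE)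
  then have "w \<in> V" "rt w = rt u" "rt w \<noteq> w" by (auto simp: C_def)
  then show ?thesis using w(1) by blast
qed

section \<open>Induced embeddings and their codes\<close>

definition embeds :: "'a set \<Rightarrow> 'a set set \<Rightarrow> 'b set \<Rightarrow> 'b set set \<Rightarrow> ('a \<Rightarrow> 'b) \<Rightarrow> bool" where
  "embeds V E W F f \<longleftrightarrow> inj_on f V \<and> f ` V \<subseteq> W \<and> (\<forall>u\<in>V. \<forall>v\<in>V. {u, v} \<in> E \<longleftrightarrow> {f u, f v} \<in> F)"

text \<open>The image of S has the same size and spans at least as many edges of the host. The claim
  is limited to subsets of V because \<open>f\<close> is injective only there.\<close>

lemma embeds_locally_sparse:
  assumes V: "finite V" and E: "\<forall>e\<in>E. e \<subseteq> V \<and> card e = 2" and f: "embeds V E W F f"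
    and sp: "locally_sparse g F" and S: "S \<subseteq> V" "S \<noteq> {}" "card S \<le> g"
  shows "card {e \<in> E. e \<subseteq> S} < card S"
proof -
  have inj: "inj_on f S" using f S inj_on_subset by (auto simp: embeds_def)
  have finS: "finite S" using S V finite_subset by blast
  have cS: "card (f ` S) = card S" using inj by (rule card_image)
  have "card {e \<in> E. e \<subseteq> S} \<le> card {e \<in> F. e \<subseteq> f ` S}"
  proof (rule card_inj_on_le)
    show "inj_on ((`) f) {e \<in> E. e \<subseteq> S}"
      using inj by (auto intro!: inj_onI simp: inj_on_image_eq_iff)
    show "(`) f ` {e \<in> E. e \<subseteq> S} \<subseteq> {e \<in> F. e \<subseteq> f ` S}"
    proof
      fix e' assume "e' \<in> (`) f ` {e \<in> E. e \<subseteq> S}"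
      then obtain e where e: "e \<in> E" "e \<subseteq> S" "e' = f ` e" by blast
      obtain x y where "e = {x, y}" using E e(1) by (meson card_2_iff)
      then show "e' \<in> {e \<in> F. e \<subseteq> f ` S}" using e f S by (auto simp: embeds_def)
    qed
    show "finite {e \<in> F. e \<subseteq> f ` S}"
      by (rule finite_subset[of _ "Pow (f ` S)"]) (use finS in auto)
  qed
  also have "\<dots> < card (f ` S)"
    using sp[unfolded locally_sparse_def, rule_format, of "f ` S"] S finS cS by simp
  finally show ?thesis using cS by simp
qed

text \<open>A numbering of the neighbours of \<open>x\<close> fixed by the host alone, so that a
  neighbour can be stored as a number below the degree and recovered without knowing the
  embedding.\<close>

definition port :: "'b set set \<Rightarrow> 'b \<Rightarrow> nat \<Rightarrow> 'b" where
  "port F x = (SOME h. nbhd F x \<subseteq> h ` {..<card (nbhd F x)})"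

lemma nbhd_subset_port:
  assumes "finite (nbhd F x)"
  shows "nbhd F x \<subseteq> port F x ` {..<card (nbhd F x)}"
proof -
  obtain h where "bij_betw h {0..<card (nbhd F x)} (nbhd F x)"
    using ex_bij_betw_nat_finite[OF assms] by blast
  then have "nbhd F x \<subseteq> h ` {..<card (nbhd F x)}" by (auto simp: bij_betw_def lessThan_atLeast0)
  then show ?thesis
    unfolding port_def by (rule someI[of "\<lambda>h. nbhd F x \<subseteq> h ` {..<card (nbhd F x)}"])
qed

definition index_of :: "'a set \<Rightarrow> 'a \<Rightarrow> nat" where
  "index_of R = (SOME h. bij_betw h R {0..<card R})"

lemma bij_betw_index_of: "finite R \<Longrightarrow> bij_betw (index_of R) R {0..<card R}"
  unfolding index_of_def by (drule ex_bij_betw_finite_nat) (rule someI_ex[of "\<lambda>h. bij_betw h R {0..<card R}"])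

text \<open>A labelled graph on \<open>V\<close> with an embedding \<open>f\<close> into the host \<open>F\<close> is encoded by the parent map
  \<open>p\<close> of a rooted spanning forest (\<open>0\<close> at the roots), the union \<open>B\<close> of the large components, the
  positions \<open>r\<close> of the roots of \<open>B\<close> in the host, and for each other vertex \<open>v\<close> of \<open>B\<close> the index \<open>q v\<close> of
  \<open>f v\<close> among the neighbours of \<open>f (p v)\<close>.\<close>

definition codes ::
  "nat set \<Rightarrow> nat set set \<Rightarrow> 'b set set \<Rightarrow> (nat \<Rightarrow> nat) \<Rightarrow> nat set \<Rightarrow> (nat \<Rightarrow> nat) \<Rightarrow> (nat \<Rightarrow> 'b) \<Rightarrow> bool" where
  "codes V E F p B q r \<longleftrightarrow> (\<exists>f (rank :: nat \<Rightarrow> nat).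
     (\<forall>v\<in>B. p v \<noteq> 0 \<longrightarrow> p v \<in> B \<and> rank (p v) < rank v \<and> f v = port F (f (p v)) (q v)) \<and>
     (\<forall>v\<in>B. p v = 0 \<longrightarrow> f v = r (index_of {v \<in> B. p v = 0} v)) \<and>
     E = {{w, p w} |w. w \<in> V - B \<and> p w \<noteq> 0} \<union> {{u, v} |u v. u \<in> B \<and> v \<in> B \<and> {f u, f v} \<in> F})"

text \<open>The code determines the embedding on B: roots are placed by \<open>r\<close>, and every
  other vertex by its parent and its port, by induction on \<open>rank\<close>. The edges inside B
  are then read off from the host, and those outside are parent edges.\<close>

lemma codes_inject:
  assumes "codes V E F p B q r" "codes V E' F p B q r"
  shows "E = E'"
proof -
  obtain f and rank :: "nat \<Rightarrow> nat" where f: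
    "\<forall>v\<in>B. p v \<noteq> 0 \<longrightarrow> p v \<in> B \<and> rank (p v) < rank v \<and> f v = port F (f (p v)) (q v)"
    "\<forall>v\<in>B. p v = 0 \<longrightarrow> f v = r (index_of {v \<in> B. p v = 0} v)"
    "E = {{w, p w} |w. w \<in> V - B \<and> p w \<noteq> 0} \<union> {{u, v} |u v. u \<in> B \<and> v \<in> B \<and> {f u, f v} \<in> F}"
    using assms(1) unfolding codes_def by blast
  obtain f' and rank' :: "nat \<Rightarrow> nat" where f':
    "\<forall>v\<in>B. p v \<noteq> 0 \<longrightarrow> p v \<in> B \<and> rank' (p v) < rank' v \<and> f' v = port F (f' (p v)) (q v)"
    "\<forall>v\<in>B. p v = 0 \<longrightarrow> f' v = r (index_of {v \<in> B. p v = 0} v)"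
    "E' = {{w, p w} |w. w \<in> V - B \<and> p w \<noteq> 0} \<union> {{u, v} |u v. u \<in> B \<and> v \<in> B \<and> {f' u, f' v} \<in> F}"
    using assms(2) unfolding codes_def by blast
  have eq: "f v = f' v" if "v \<in> B" for v using that
  proof (induction "rank v" arbitrary: v rule: less_induct)
    case less
    show ?case
    proof (cases "p v = 0")
      case True
      then show ?thesis using f(2) f'(2) less.prems by simp
    next
      case False
      then have "f (p v) = f' (p v)" using f(1) less by blast
      then show ?thesis using False f(1) f'(1) less.prems by simp
    qed
  qed
  have "{{u, v} |u v. u \<in> B \<and> v \<in> B \<and> {f u, f v} \<in> F} = {{u, v} |u v. u \<in> B \<and> v \<in> B \<and> {f' u, f' v} \<in> F}"
    by (intro Collect_cong ex_cong1 conj_cong refl) (simp add: eq)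
  then show ?thesis using f(3) f'(3) by simp
qed

text \<open>A graph may have many codes; one is chosen for each graph, and no code serves two
  graphs.\<close>

lemma card_le_if_injective_relation:
  assumes "finite Y" "\<And>x. x \<in> X \<Longrightarrow> \<exists>y\<in>Y. R x y" "\<And>x x' y. R x y \<Longrightarrow> R x' y \<Longrightarrow> x = x'"
  shows "card X \<le> card Y"
proof -
  obtain h where "\<And>x. x \<in> X \<Longrightarrow> h x \<in> Y \<and> R x (h x)" using assms(2) by metis
  then show ?thesis using assms(1,3) by (intro card_inj_on_le[of h]) (auto intro!: inj_onI, metis)
qed

text \<open>B is the union of the components with more than \<open>g\<close> vertices, so it has at
  most \<open>n div g\<close> roots. The other components are trees by
  \<open>sparse_component_edge\<close>, and their parent edges describe them completely.\<close>

lemma exists_codes: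
  fixes F :: "nat set set"
  assumes V: "V = {1..n}" and E: "\<forall>e\<in>E. e \<subseteq> V \<and> card e = 2" and W: "\<Union>F \<subseteq> W" "0 \<in> W" "finite W"
    and f: "embeds V E W F f" and sp: "locally_sparse g F" and g: "g \<ge> 1"
    and deg: "\<And>v. card (nbhd F v) \<le> d"
  shows "\<exists>p\<in>V \<rightarrow>\<^sub>E {0..n}. \<exists>B\<in>Pow V. \<exists>q\<in>V \<rightarrow>\<^sub>E {..d}. \<exists>r\<in>{..<n div g} \<rightarrow>\<^sub>E W.
    codes V E F p B q r \<and> (n \<le> g \<longrightarrow> B = {})"
proof -
  have finV: "finite V" using V by simp
  have EV: "\<Union>E \<subseteq> V" using E by blast
  obtain rt P and rank :: "nat \<Rightarrow> nat" where
    rt: "\<And>v. rt (rt v) = rt v" "\<And>u v. {u, v} \<in> E \<Longrightarrow> rt u = rt v"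
    and P: "\<And>v. rt v \<noteq> v \<Longrightarrow> {v, P v} \<in> E" "\<And>v. rt v \<noteq> v \<Longrightarrow> rank (P v) < rank v"
    and rtV': "\<And>V v. \<Union>E \<subseteq> V \<Longrightarrow> v \<in> V \<Longrightarrow> rt v \<in> V"
    by (rule rooted_spanning_forest[of E]) (rule that; assumption)
  have rtV: "rt v \<in> V" if "v \<in> V" for v using rtV'[OF EV that] .
  have PV: "P v \<in> V" "rt (P v) = rt v" if "rt v \<noteq> v" for v
    using P(1)[OF that] EV rt(2)[of v "P v"] by auto
  have fF: "{f u, f v} \<in> F \<longleftrightarrow> {u, v} \<in> E" if "u \<in> V" "v \<in> V" for u v
    using f that by (simp add: embeds_def)
  have fW: "f v \<in> W" if "v \<in> V" for v using f that by (auto simp: embeds_def)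
  have finN: "finite (nbhd F x)" for x
    by (rule finite_subset[OF _ W(3)]) (use W(1) in \<open>auto simp: nbhd_def\<close>)
  \<comment> \<open>Labels start at 1, so 0 is free to mark the roots.\<close>
  define p where "p = restrict (\<lambda>v. if rt v = v then 0 else P v) V"
  have p0: "p v = 0 \<longleftrightarrow> rt v = v" and p1: "rt v \<noteq> v \<Longrightarrow> p v = P v" if "v \<in> V" for v
    using that PV[of v] by (auto simp: p_def V)
  define B where "B = {v \<in> V. g < card {u \<in> V. rt u = rt v}}"
  define R where "R = {v \<in> B. p v = 0}"
  have BV: "B \<subseteq> V" by (auto simp: B_def)
  have finR: "finite R" using finV by (simp add: R_def B_def)
  have Rrt: "rt v = v" if "v \<in> R" for v using that p0 BV by (auto simp: R_def)
  have "g \<le> card {u \<in> V. rt u = v}" if "v \<in> R" for v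
    using that Rrt[OF that] by (simp add: R_def B_def)
  then have "card R * g \<le> (\<Sum>v\<in>R. card {u \<in> V. rt u = v})"
    by (intro sum_bounded_below[of R g, unfolded of_nat_id])
  also have "\<dots> = card (\<Union>v\<in>R. {u \<in> V. rt u = v})"
    using finR finV by (intro card_UN_disjoint[symmetric]) auto
  also have "\<dots> \<le> card V" using finV by (intro card_mono) auto
  finally have cR: "card R \<le> n div g" using g V by (simp add: less_eq_div_iff_mult_less_eq)
  \<comment> \<open>At a root every index up to \<open>d\<close> is admissible. The range
    \<open>{..d}\<close> has \<open>d + 1\<close> elements, which gives the base 13 in the later
    count.\<close>
  define q where "q = restrict (\<lambda>v. SOME i. i \<le> d \<and> (rt v \<noteq> v \<longrightarrow> f v = port F (f (P v)) i)) V"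
  have q: "q v \<le> d" "rt v \<noteq> v \<Longrightarrow> f v = port F (f (P v)) (q v)" if v: "v \<in> V" for v
  proof -
    have "\<exists>i. i \<le> d \<and> (rt v \<noteq> v \<longrightarrow> f v = port F (f (P v)) i)"
    proof (cases "rt v = v")
      case False
      then have "{f (P v), f v} \<in> F" using fF[OF v PV(1)] P(1)[of v] by (simp add: insert_commute)
      then obtain i where i: "i < card (nbhd F (f (P v)))" "f v = port F (f (P v)) i"
        using nbhd_subset_port[OF finN[of "f (P v)"]] by (auto simp: nbhd_def)
      then have "i \<le> d" using deg[of "f (P v)"] by linarith
      then show ?thesis using i by blast
    qed auto
    then have "q v \<le> d \<and> (rt v \<noteq> v \<longrightarrow> f v = port F (f (P v)) (q v))"
      unfolding q_def using v by (simp only: restrict_apply if_True) (rule someI_ex)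
    then show "q v \<le> d" "rt v \<noteq> v \<Longrightarrow> f v = port F (f (P v)) (q v)" by auto
  qed
  \<comment> \<open>Positions beyond the last root are filled with 0, a vertex of the host.\<close>
  define r where "r = restrict (\<lambda>i. if i < card R then f (inv_into R (index_of R) i) else 0) {..<n div g}"
  have bij: "bij_betw (index_of R) R {0..<card R}" by (rule bij_betw_index_of[OF finR])
  have r: "r (index_of R v) = f v" if "v \<in> R" for v
  proof -
    have "index_of R v < card R" using bij that by (auto simp: bij_betw_def)
    moreover have "inv_into R (index_of R) (index_of R v) = v"
      using bij that by (intro inv_into_f_f) (auto simp: bij_betw_def)
    ultimately show ?thesis using cR by (simp add: r_def)
  qed
  have "codes V E F p B q r"
    unfolding codes_def
  proof (intro exI conjI ballI impI)
    fix v assume v: "v \<in> B" "p v \<noteq> 0"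
    then have vV: "v \<in> V" using BV by blast
    then have rtv: "rt v \<noteq> v" using p0 v(2) by simp
    then show "p v \<in> B" "rank (p v) < rank v" "f v = port F (f (p v)) (q v)"
      using p1[OF vV rtv] PV[OF rtv] P(2)[OF rtv] q(2)[OF vV rtv] v(1) by (auto simp: B_def)
  next
    fix v assume "v \<in> B" "p v = 0"
    then show "f v = r (index_of {v \<in> B. p v = 0} v)" using r unfolding R_def by simp
  next
    show "E = {{w, p w} |w. w \<in> V - B \<and> p w \<noteq> 0} \<union> {{u, v} |u v. u \<in> B \<and> v \<in> B \<and> {f u, f v} \<in> F}"
      (is "E = ?L \<union> ?R")
    proof
      show "?L \<union> ?R \<subseteq> E"
      proof
        fix e assume "e \<in> ?L \<union> ?R"
        then consider w where "w \<in> V" "p w \<noteq> 0" "e = {w, p w}"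
          | u v where "u \<in> B" "v \<in> B" "{f u, f v} \<in> F" "e = {u, v}" by blast
        then show "e \<in> E"
        proof cases
          case 1
          then show ?thesis using p0 p1 P(1) by metis
        next
          case 2
          then show ?thesis using fF BV by blast
        qed
      qed
      show "E \<subseteq> ?L \<union> ?R"
      proof
        fix e assume e: "e \<in> E"
        then obtain u v where uv: "e = {u, v}" using E by (meson card_2_iff)
        have mem: "u \<in> V" "v \<in> V" and eq: "rt u = rt v" using e uv EV rt(2) by auto
        show "e \<in> ?L \<union> ?R"
        proof (cases "u \<in> B")
          case True
          then have "v \<in> B" using mem eq by (simp add: B_def)
          then show ?thesis using True fF[OF mem] e uv by blast
        next
          case False
          then have small: "card {w \<in> V. rt w = rt u} \<le> g" using mem by (auto simp: B_def)
          have "\<exists>w\<in>V. rt w = rt u \<and> rt w \<noteq> w \<and> {u, v} = {w, P w}"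
            using e uv by (intro sparse_component_edge[where rt = rt and p = P and rank = rank and g = g,
                OF finV E embeds_locally_sparse[OF finV E f sp] rt rtV P _ small]) auto
          then obtain w where w: "w \<in> V" "rt w = rt u" "rt w \<noteq> w" "e = {w, P w}" using uv by blast
          have "w \<in> V - B" using small w(1,2) by (simp add: B_def)
          moreover have "p w \<noteq> 0" using p0 w(1,3) by blast
          moreover have "e = {w, p w}" using p1[OF w(1,3)] w(4) by simp
          ultimately show ?thesis by blast
        qed
      qed
    qed
  qed
  moreover have "p \<in> V \<rightarrow>\<^sub>E {0..n}"
    using PV(1) unfolding p_def V by (intro restrict_PiE_iff[THEN iffD2]) auto
  moreover have "q \<in> V \<rightarrow>\<^sub>E {..d}" using q(1) by (intro PiE_I) (auto simp: q_def)
  moreover have "r \<in> {..<n div g} \<rightarrow>\<^sub>E W"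
  proof (intro PiE_I)
    fix i
    have "f (inv_into R (index_of R) i) \<in> W" if "i < card R"
    proof (rule fW)
      have "i \<in> index_of R ` R" using bij that by (auto simp: bij_betw_def)
      then show "inv_into R (index_of R) i \<in> V" using inv_into_into[of i "index_of R" R] BV by (auto simp: R_def)
    qed
    then show "i \<in> {..<n div g} \<Longrightarrow> r i \<in> W" using W(2) by (simp add: r_def)
  qed (simp add: r_def)
  moreover have "B = {}" if "n \<le> g"
  proof -
    have "card {u \<in> V. rt u = rt v} \<le> g" for v
    proof -
      have "card {u \<in> V. rt u = rt v} \<le> card V" using finV by (intro card_mono) auto
      then show ?thesis using that V by simp
    qed
    then show ?thesis by (simp add: B_def not_less[symmetric] leD)
  qed
  moreover have "B \<in> Pow V" using BV by simp
  ultimately show ?thesis by blast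
qed

text \<open>The codes consist of a parent map, a set B, ports and root positions. The constant is
  \<open>1352 = 2 * 13 * (4 * 13)\<close>.\<close>

lemma card_embedded_le:
  fixes F :: "nat set set"
  assumes F: "\<forall>e\<in>F. e \<subseteq> {0..<4 * 13 ^ g} \<and> card e = 2" and deg: "\<And>v. card (nbhd F v) \<le> 12"
    and sp: "locally_sparse g F" and g: "g \<ge> 1"
  shows "card {E. (\<forall>e\<in>E. e \<subseteq> {1..n} \<and> card e = 2) \<and> (\<exists>f. embeds {1..n} E {0..<4 * 13 ^ g} F f)}
    \<le> (n + 1) ^ n * 1352 ^ n" (is "card ?X \<le> _")
proof -
  let ?V = "{1..n}" and ?W = "{0..<4 * 13 ^ g} :: nat set"
  let ?Y = "(?V \<rightarrow>\<^sub>E {0..n}) \<times> Pow ?V \<times> (?V \<rightarrow>\<^sub>E {..12::nat}) \<times> ({..<n div g} \<rightarrow>\<^sub>E ?W)"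
  have "card ?X \<le> card ?Y"
  proof (rule card_le_if_injective_relation[where R = "\<lambda>E (p, B, q, r). codes ?V E F p B q r"])
    show "finite ?Y" by (intro finite_cartesian_product finite_PiE) auto
    fix E assume "E \<in> ?X"
    then obtain f where E: "\<forall>e\<in>E. e \<subseteq> ?V \<and> card e = 2" and f: "embeds ?V E ?W F f" by blast
    have "\<exists>p\<in>?V \<rightarrow>\<^sub>E {0..n}. \<exists>B\<in>Pow ?V. \<exists>q\<in>?V \<rightarrow>\<^sub>E {..12}. \<exists>r\<in>{..<n div g} \<rightarrow>\<^sub>E ?W.
        codes ?V E F p B q r \<and> (n \<le> g \<longrightarrow> B = {})"
      by (rule exists_codes[OF refl E _ _ _ f sp g deg]) (use F in auto)
    then obtain p B q r where "(p, B, q, r) \<in> ?Y" "codes ?V E F p B q r" by blast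
    then show "\<exists>y\<in>?Y. case y of (p, B, q, r) \<Rightarrow> codes ?V E F p B q r"
      by (intro bexI[of _ "(p, B, q, r)"]) simp_all
  next
    fix E E' and y :: "(nat \<Rightarrow> nat) \<times> nat set \<times> (nat \<Rightarrow> nat) \<times> (nat \<Rightarrow> nat)"
    assume "case y of (p, B, q, r) \<Rightarrow> codes ?V E F p B q r" "case y of (p, B, q, r) \<Rightarrow> codes ?V E' F p B q r"
    then show "E = E'" by (auto split: prod.splits dest: codes_inject)
  qed
  also have "\<dots> = (n + 1) ^ n * 2 ^ n * 13 ^ n * (4 * 13 ^ g) ^ (n div g)"
    by (simp add: card_cartesian_product card_PiE card_Pow)
  \<comment> \<open>The host is exponentially large in \<open>g\<close>, but there is at most one
    stored root per \<open>g\<close> vertices, so the cost per vertex stays constant.\<close>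
  also have "(4 * 13 ^ g) ^ (n div g) \<le> (4 * 13 :: nat) ^ n"
  proof -
    have "(4 * 13 ^ g) ^ (n div g) = (4::nat) ^ (n div g) * 13 ^ (g * (n div g))"
      by (simp add: power_mult_distrib power_mult)
    also have "\<dots> \<le> 4 ^ n * 13 ^ n"
      by (intro mult_mono power_increasing) (auto simp: div_le_dividend)
    finally show ?thesis by (simp only: power_mult_distrib)
  qed
  also have "(n + 1) ^ n * 2 ^ n * 13 ^ n * (4 * 13) ^ n = (n + 1) ^ n * (2 * 13 * (4 * 13)) ^ n"
    by (simp only: power_mult_distrib ac_simps)
  finally show ?thesis by simp
qed

text \<open>Hosts with \<open>g k\<close> at least \<open>n\<close> contribute only forests. Their
  codes have empty B and do not depend on the host, so infinitely many hosts are handled by one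
  count of parent maps.\<close>

lemma card_embedded_forests_le:
  fixes F :: "'i \<Rightarrow> nat set set"
  assumes F: "\<And>k. k \<in> I \<Longrightarrow> \<forall>e\<in>F k. e \<subseteq> {0..<4 * 13 ^ g k} \<and> card e = 2"
    and deg: "\<And>k v. k \<in> I \<Longrightarrow> card (nbhd (F k) v) \<le> 12"
    and sp: "\<And>k. k \<in> I \<Longrightarrow> locally_sparse (g k) (F k)" and g: "\<And>k. k \<in> I \<Longrightarrow> g k \<ge> max n 1"
  shows "card {E. (\<forall>e\<in>E. e \<subseteq> {1..n} \<and> card e = 2) \<and> (\<exists>k\<in>I. \<exists>f. embeds {1..n} E {0..<4 * 13 ^ g k} (F k) f)}
    \<le> (n + 1) ^ n" (is "card ?X \<le> _")
proof -
  let ?V = "{1..n}"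
  let ?E = "\<lambda>p. {{w, p w} |w. w \<in> ?V \<and> p w \<noteq> 0}"
  have "?X \<subseteq> ?E ` (?V \<rightarrow>\<^sub>E {0..n})"
  proof
    fix E assume "E \<in> ?X"
    then obtain k f where E: "\<forall>e\<in>E. e \<subseteq> ?V \<and> card e = 2" and k: "k \<in> I"
      and f: "embeds ?V E {0..<4 * 13 ^ g k} (F k) f" by blast
    have g1: "1 \<le> g k" "n \<le> g k" using g[OF k] by auto
    have "\<exists>p\<in>?V \<rightarrow>\<^sub>E {0..n}. \<exists>B\<in>Pow ?V. \<exists>q\<in>?V \<rightarrow>\<^sub>E {..12}. \<exists>r\<in>{..<n div g k} \<rightarrow>\<^sub>E {0..<4 * 13 ^ g k}.
        codes ?V E (F k) p B q r \<and> (n \<le> g k \<longrightarrow> B = {})"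
      by (rule exists_codes[OF refl E _ _ _ f sp[OF k] g1(1) deg[OF k]]) (use F[OF k] in auto)
    then obtain p q r where p: "p \<in> ?V \<rightarrow>\<^sub>E {0..n}" "codes ?V E (F k) p {} q r"
      using g1(2) by blast
    then have "E = ?E p" unfolding codes_def by simp
    then show "E \<in> ?E ` (?V \<rightarrow>\<^sub>E {0..n})" using p(1) by (rule image_eqI)
  qed
  then have "card ?X \<le> card (?V \<rightarrow>\<^sub>E {0..n})"
    by (intro surj_card_le finite_PiE) auto
  then show ?thesis by (simp add: card_PiE)
qed

text \<open>The quotient of the power and the factorial is a single term of the exponential series
  at \<open>n\<close>.\<close>

lemma power_self_le_exp_fact: "real n ^ n \<le> exp (real n) * fact n"
proof -
  have "(\<Sum>k\<in>{n}. real n ^ k /\<^sub>R fact k) \<le> (\<Sum>k. real n ^ k /\<^sub>R fact k)"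
    by (intro sum_le_suminf summable_exp_generic) auto
  then have "real n ^ n / fact n \<le> exp (real n)"
    by (simp add: exp_def scaleR_conv_of_real divide_inverse mult.commute)
  then show ?thesis by (simp add: divide_le_eq)
qed

text \<open>The leading factor \<open>n + 1\<close> will stand for \<open>n\<close> single hosts and
  one count for all others. The estimates \<open>n + 1 \<le> 2 ^ n\<close> and
  \<open>n + 1 \<le> 2 * n\<close> cost a factor 4 per vertex, and
  \<open>5408 = 4 * 1352\<close>.\<close>

lemma labelled_count_bound:
  assumes "n \<ge> 1"
  shows "real ((n + 1) * ((n + 1) ^ n * 1352 ^ n)) \<le> fact n * (5408 * exp 1) ^ n"
proof -
  have "n < 2 ^ n" by (rule less_exp)
  then have "n + 1 \<le> 2 ^ n" by (simp only: Suc_eq_plus1[symmetric] Suc_le_eq)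
  moreover have "(n + 1) ^ n \<le> (2 * n) ^ n" using assms by (intro power_mono) auto
  ultimately have "(n + 1) * ((n + 1) ^ n * 1352 ^ n) \<le> 2 ^ n * ((2 * n) ^ n * 1352 ^ n)"
    by (intro mult_mono) auto
  also have "\<dots> = n ^ n * (2 * 2 * 1352) ^ n" by (simp only: power_mult_distrib ac_simps)
  finally have "real ((n + 1) * ((n + 1) ^ n * 1352 ^ n)) \<le> real (n ^ n * (2 * 2 * 1352) ^ n)"
    by (rule of_nat_mono)
  also have "\<dots> = real n ^ n * 5408 ^ n" by simp
  also have "\<dots> \<le> exp (real n) * fact n * 5408 ^ n"
    by (intro mult_right_mono power_self_le_exp_fact) simp
  also have "exp (real n) = exp 1 ^ n" by (simp add: exp_of_nat_mult[symmetric])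
  also have "exp 1 ^ n * fact n * 5408 ^ n = fact n * (5408 * exp 1 :: real) ^ n"
    by (simp add: power_mult_distrib)
  finally show ?thesis .
qed

section \<open>The class of induced subgraphs of the hosts\<close>

lemma embeds_comp_iso:
  assumes H: "embeds (verts G) (edges G) W F f" and iso: "isomorphic G H"
  shows "\<exists>f. embeds (verts H) (edges H) W F f"
proof -
  obtain h where h: "bij_betw h (verts G) (verts H)"
    "\<forall>u\<in>verts G. \<forall>v\<in>verts G. {u, v} \<in> edges G \<longleftrightarrow> {h u, h v} \<in> edges H"
    using iso unfolding isomorphic_def by blast
  define j where "j = the_inv_into (verts G) h"
  have j: "bij_betw j (verts H) (verts G)"
    unfolding j_def by (rule bij_betw_the_inv_into[OF h(1)])
  have hj: "h (j v) = v" "j v \<in> verts G" if "v \<in> verts H" for v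
    using that h(1) j f_the_inv_into_f_bij_betw[OF h(1)] by (auto simp: j_def bij_betw_def)
  have "{u, v} \<in> edges H \<longleftrightarrow> {f (j u), f (j v)} \<in> F" if "u \<in> verts H" "v \<in> verts H" for u v
    using h(2)[rule_format, OF hj(2)[OF that(1)] hj(2)[OF that(2)]] H hj[OF that(1)] hj[OF that(2)]
    by (auto simp: embeds_def)
  moreover have "inj_on (f \<circ> j) (verts H)"
    using j H by (intro comp_inj_on) (auto simp: bij_betw_def embeds_def)
  moreover have "(f \<circ> j) ` verts H \<subseteq> W" using j H by (auto simp: bij_betw_def embeds_def)
  ultimately have "embeds (verts H) (edges H) W F (f \<circ> j)" by (simp add: embeds_def)
  then show ?thesis by blast
qed

theorem corollary1p4:
  shows "\<exists>C :: nat graph set.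
           graph_class C \<and> hereditary C \<and> small C \<and>
           (SUP G\<in>C. enat (twin_width G)) = \<infinity>"
proof -
  let ?W = "\<lambda>g. {0..<4 * 13 ^ g} :: nat set"
  \<comment> \<open>The bound \<open>Suc k \<le> g\<close> makes the hosts with index at least
    \<open>n\<close> look like forests to every graph on \<open>n\<close> vertices.\<close>
  have "\<exists>g F. Suc k \<le> g \<and> (\<forall>e\<in>F. e \<subseteq> ?W g \<and> card e = 2) \<and> (\<forall>v. card (nbhd F v) \<le> 12) \<and>
     locally_sparse g F \<and> k < twin_width (Graph (?W g) F)" for k
    using locally_sparse_large_twin_width[of "Suc k"] Suc_lessD by blast
  then obtain g and F :: "nat \<Rightarrow> nat set set" where g: "\<And>k. Suc k \<le> g k"
    and F: "\<And>k. \<forall>e\<in>F k. e \<subseteq> ?W (g k) \<and> card e = 2" and deg: "\<And>k v. card (nbhd (F k) v) \<le> 12"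
    and sp: "\<And>k. locally_sparse (g k) (F k)" and tww: "\<And>k. k < twin_width (Graph (?W (g k)) (F k))"
    by metis
  define C where "C = {H :: nat graph. finite_graph H \<and>
    (\<exists>k f. embeds (verts H) (edges H) (?W (g k)) (F k) f)}"
  have "graph_class C"
    unfolding graph_class_def C_def using embeds_comp_iso by blast
  moreover have "hereditary C"
    unfolding hereditary_def
  proof (intro ballI allI impI)
    fix G S assume G: "G \<in> C" "S \<subseteq> verts G"
    then obtain k f where f: "embeds (verts G) (edges G) (?W (g k)) (F k) f" by (auto simp: C_def)
    have "embeds S {e \<in> edges G. e \<subseteq> S} (?W (g k)) (F k) f"
      using f G(2) unfolding embeds_def by (auto intro: inj_on_subset)
    moreover have "finite_graph (induced_subgraph G S)"
      using G finite_subset unfolding C_def finite_graph_def induced_subgraph_def by auto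
    ultimately show "induced_subgraph G S \<in> C"
      unfolding C_def induced_subgraph_def by auto
  qed
  moreover have "small C"
    unfolding small_def
  proof (intro exI[of _ "5408 * exp 1"] allI impI)
    fix n :: nat assume n: "n \<ge> 1"
    let ?X = "\<lambda>k. {E. (\<forall>e\<in>E. e \<subseteq> {1..n} \<and> card e = 2) \<and> (\<exists>f. embeds {1..n} E (?W (g k)) (F k) f)}"
    let ?Z = "{E. (\<forall>e\<in>E. e \<subseteq> {1..n} \<and> card e = 2) \<and> (\<exists>k\<in>{n..}. \<exists>f. embeds {1..n} E (?W (g k)) (F k) f)}"
    have fin: "finite {E. (\<forall>e\<in>E. e \<subseteq> {1..n} \<and> card e = 2) \<and> Q E}" for Q
      by (rule finite_subset[of _ "Pow (Pow {1..n})"]) auto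
    \<comment> \<open>Hosts with index below \<open>n\<close> are counted one at a time, all the
      others together.\<close>
    have "{G \<in> C. verts G = {1..n}} \<subseteq> Graph {1..n} ` ((\<Union>k<n. ?X k) \<union> ?Z)"
    proof
      fix G assume "G \<in> {G \<in> C. verts G = {1..n}}"
      then obtain k f where G: "verts G = {1..n}" "\<forall>e\<in>edges G. e \<subseteq> {1..n} \<and> card e = 2"
        "embeds {1..n} (edges G) (?W (g k)) (F k) f" by (auto simp: C_def finite_graph_def)
      then have "edges G \<in> (\<Union>k<n. ?X k) \<union> ?Z" by (cases "k < n") auto
      then show "G \<in> Graph {1..n} ` ((\<Union>k<n. ?X k) \<union> ?Z)" 
        by (intro image_eqI[of _ _ "edges G"]) (simp_all only: G(1)[symmetric] graph.collapse)
    qed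
    then have "card {G \<in> C. verts G = {1..n}} \<le> card ((\<Union>k<n. ?X k) \<union> ?Z)"
      by (rule surj_card_le[rotated]) (intro finite_UnI finite_UN_I finite_lessThan fin)
    also have "\<dots> \<le> card (\<Union>k<n. ?X k) + card ?Z" by (rule card_Un_le)
    also have "\<dots> \<le> (\<Sum>k<n. card (?X k)) + card ?Z" by (intro add_right_mono card_UN_le) simp
    also have "\<dots> \<le> (\<Sum>k<n. (n + 1) ^ n * 1352 ^ n) + (n + 1) ^ n * 1352 ^ n"
    proof (intro add_mono sum_mono)
      fix k
      show "card (?X k) \<le> (n + 1) ^ n * 1352 ^ n"
        using g[of k] by (intro card_embedded_le F deg sp) auto
    next
      have "g k \<ge> max n 1" if "k \<in> {n..}" for k using g[of k] that by auto
      then have "card ?Z \<le> (n + 1) ^ n" by (intro card_embedded_forests_le F deg sp)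
      also have "\<dots> \<le> (n + 1) ^ n * 1352 ^ n" by simp
      finally show "card ?Z \<le> (n + 1) ^ n * 1352 ^ n" .
    qed
    also have "\<dots> = (n + 1) * ((n + 1) ^ n * 1352 ^ n)" by simp
    finally have "real (card {G \<in> C. verts G = {1..n}}) \<le> real ((n + 1) * ((n + 1) ^ n * 1352 ^ n))"
      by (rule of_nat_mono)
    also have "\<dots> \<le> fact n * (5408 * exp 1) ^ n" by (rule labelled_count_bound[OF n])
    finally show "real (card {G \<in> C. verts G = {1..n}}) \<le> fact n * (5408 * exp 1) ^ n" .
  qed
  moreover have "(SUP G\<in>C. enat (twin_width G)) = \<infinity>"
  proof (rule ccontr)
    assume "(SUP G\<in>C. enat (twin_width G)) \<noteq> \<infinity>"
    then obtain k where k: "(SUP G\<in>C. enat (twin_width G)) = enat k" by auto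
    \<comment> \<open>Each host belongs to the class itself, so its twin-width bounds the supremum
      from below.\<close>
    have "embeds (?W (g k)) (F k) (?W (g k)) (F k) id" by (simp add: embeds_def)
    then have "Graph (?W (g k)) (F k) \<in> C"
      using F[of k] unfolding C_def finite_graph_def by auto
    then have "enat (twin_width (Graph (?W (g k)) (F k))) \<le> enat k"
      unfolding k[symmetric] by (rule SUP_upper)
    then show False using tww[of k] by simp
  qed
  ultimately show ?thesis by blast
qed

end
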